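(* Let $\sigma$ be a primitive substitution on a finite alphabet $A$, let $X$ be its shift space, and let $\varphi\colon A^*\to G$ be a (monoid) morphism onto a finite group $G$. If $\sigma$ is invertible under $\varphi$, then the minimal closed invariant subsets of $G\rtimes_\varphi X$ are uniquely ergodic.
   Context: A substitution is a monoid endomorphism $\sigma\colon A^*\to A^*$; it is primitive if there is $n\ge1$ such that for all $a,b\in A$ the letter $b$ occurs in $\sigma^n(a)$. Its shift space $X=X(\sigma)$ is the set of $x\in A^{\mathbb Z}$ all of whose finite factors occur in some $\sigma^n(a)$, $n\ge0$, $a\in A$ (shift spaces are assumed nonempty), with the shift map $S((x_n)_n)=(x_{n+1})_n$. The substitution $\sigma$ is invertible under $\varphi$ if there exists $n\ge1$ with $\varphi\circ\sigma^n=\varphi$. The skew product $G\rtimes_\varphi X$ is the dynamical system $(G\times X,T_\varphi)$, $G$ discrete, with $T_\varphi(g,x)=(g\varphi(x_0),Sx)$. A minimal closed invariant subset $Y$ is a nonempty closed $T_\varphi$-invariant subset with no proper nonempty closed $T_\varphi$-invariant subset; it is uniquely ergodic if there is exactly one $T_\varphi$-invariant Borel probability measure on $Y$. *)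

theory Defs
  imports "HOL-Probability.Probability_Measure" "HOL-Algebra.Group" "HOL-Library.Sublist"
begin

definition free_monoid :: "'a list monoid" where
  "free_monoid = \<lparr>carrier = UNIV, mult = (@), one = []\<rparr>"

text \<open>In contrast to \<^const>\<open>hom\<close>, preservation of the unit is required explicitly.\<close>

definition monoid_morphism ::
  "('m, 'k) monoid_scheme \<Rightarrow> ('n, 'l) monoid_scheme \<Rightarrow> ('m \<Rightarrow> 'n) \<Rightarrow> bool" where
  "monoid_morphism M N h \<longleftrightarrow> h \<in> hom M N \<and> h \<one>\<^bsub>M\<^esub> = \<one>\<^bsub>N\<^esub>"

definition substitution :: "('a list \<Rightarrow> 'a list) \<Rightarrow> bool" where
  "substitution \<sigma> \<longleftrightarrow> monoid_morphism free_monoid free_monoid \<sigma>"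

definition primitive :: "('a list \<Rightarrow> 'a list) \<Rightarrow> bool" where
  "primitive \<sigma> \<longleftrightarrow> (\<exists>n\<ge>1. \<forall>a b. b \<in> set ((\<sigma> ^^ n) [a]))"

definition shift_space :: "('a list \<Rightarrow> 'a list) \<Rightarrow> (int \<Rightarrow> 'a) set" where
  "shift_space \<sigma> = {x. \<forall>i j. \<exists>n a. sublist (map x [i..j]) ((\<sigma> ^^ n) [a])}"

definition shift_map :: "(int \<Rightarrow> 'a) \<Rightarrow> (int \<Rightarrow> 'a)" where
  "shift_map x = (\<lambda>n. x (n + 1))"

definition full_shift_topology :: "(int \<Rightarrow> 'a) topology" where
  "full_shift_topology = product_topology (\<lambda>_. discrete_topology UNIV) UNIV"

definition invertible_under :: "('a list \<Rightarrow> 'g) \<Rightarrow> ('a list \<Rightarrow> 'a list) \<Rightarrow> bool" where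
  "invertible_under \<phi> \<sigma> \<longleftrightarrow> (\<exists>n\<ge>1. \<phi> \<circ> (\<sigma> ^^ n) = \<phi>)"

definition skew_topology ::
  "('g, 'k) monoid_scheme \<Rightarrow> (int \<Rightarrow> 'a) set \<Rightarrow> ('g \<times> (int \<Rightarrow> 'a)) topology" where
  "skew_topology G X =
     prod_topology (discrete_topology (carrier G)) (subtopology full_shift_topology X)"

definition skew_map ::
  "('g, 'k) monoid_scheme \<Rightarrow> ('a list \<Rightarrow> 'g) \<Rightarrow> 'g \<times> (int \<Rightarrow> 'a) \<Rightarrow> 'g \<times> (int \<Rightarrow> 'a)" where
  "skew_map G \<phi> = (\<lambda>(g, x). (g \<otimes>\<^bsub>G\<^esub> \<phi> [x 0], shift_map x))"

definition closed_invariant :: "'x topology \<Rightarrow> ('x \<Rightarrow> 'x) \<Rightarrow> 'x set \<Rightarrow> bool" where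
  "closed_invariant \<T> T Y \<longleftrightarrow> closedin \<T> Y \<and> T ` Y \<subseteq> Y"

definition minimal_closed_invariant :: "'x topology \<Rightarrow> ('x \<Rightarrow> 'x) \<Rightarrow> 'x set \<Rightarrow> bool" where
  "minimal_closed_invariant \<T> T Y \<longleftrightarrow>
     closed_invariant \<T> T Y \<and> Y \<noteq> {} \<and>
     \<not> (\<exists>Z. closed_invariant \<T> T Z \<and> Z \<noteq> {} \<and> Z \<subset> Y)"

definition borel_measurable_space :: "'x topology \<Rightarrow> 'x measure" where
  "borel_measurable_space \<T> = sigma (topspace \<T>) {U. openin \<T> U}"

definition invariant_borel_probability ::
  "'x topology \<Rightarrow> ('x \<Rightarrow> 'x) \<Rightarrow> 'x measure \<Rightarrow> bool" where
  "invariant_borel_probability \<T> T \<mu> \<longleftrightarrow>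
     sets \<mu> = sets (borel_measurable_space \<T>) \<and> prob_space \<mu> \<and>
     (\<forall>B\<in>sets \<mu>. emeasure \<mu> (T -` B \<inter> space \<mu>) = emeasure \<mu> B)"

text \<open>Equality of measures in HOL compares space, measurable sets and values (which are zero off
  the measurable sets), so the unique existence below is the usual one.\<close>

definition uniquely_ergodic :: "'x topology \<Rightarrow> ('x \<Rightarrow> 'x) \<Rightarrow> 'x set \<Rightarrow> bool" where
  "uniquely_ergodic \<T> T Y \<longleftrightarrow> (\<exists>!\<mu>. invariant_borel_probability (subtopology \<T> Y) T \<mu>)"

end

theory Submission
  imports Defs "HOL-Algebra.Multiplicative_Group"
begin

text \<open>
  Some power \<open>\<tau>\<close> of the substitution satisfies \<open>\<phi> \<circ> \<tau> = \<phi>\<close>, so \<open>\<tau>\<close> lifts to the alphabet \<open>G \<times> A\<close>: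
  the state \<open>(g, a)\<close> is replaced by the states met while reading \<open>\<tau> a\<close> starting from \<open>g\<close>.
  After a further power the support of the lifted incidence matrix is idempotent, and because
  \<open>G\<close> is finite and acts by left translations it is then an equivalence relation. On each class
  the averages of a cylinder function over the words \<open>\<tau>\<^sup>n a\<close> contract to one common value.
  Every window of a point of \<open>G \<times> X\<close> is, up to its ends, a concatenation of level-\<open>n\<close> blocks
  whose states lie in a single class, so its Birkhoff averages eventually lie near a finite set of
  values. Averages vary slowly with their length, hence they converge uniformly to a locally
  constant invariant function, which is constant on a minimal set. Uniform convergence on
  cylinders determines the invariant measure, and compactness turns the limiting frequencies
  into a premeasure, which yields existence.
\<close>

section \<open>Averages and invariant measures\<close>

text \<open>The lifted substitution need not be primitive: its states can split into several classes
  with different limiting averages, so unique ergodicity of primitive substitutions cannot simply be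
  applied to the lift. Instead of deciding which class belongs to which minimal set, the estimates
  treat all points of \<open>G \<times> X\<close> at once, and minimality selects one of the
  finitely many candidate values only at the end. The condition
  \<open>\<phi> \<circ> \<tau> = \<phi>\<close> is what makes the lift compatible with
  concatenation: reading \<open>\<tau> a\<close> from \<open>g\<close> ends in the same group
  element as reading \<open>a\<close>, so consecutive images fit together. A cylinder function looks
  a fixed distance ahead, hence sums over blocks are additive only up to a bounded cost per cut;
  this cost is absorbed because block lengths at least double at every level.\<close>

lemma average_diff_le:
  fixes f :: "nat \<Rightarrow> real"
  assumes "\<And>i. \<bar>f i\<bar> \<le> 1"
  shows "\<bar>(\<Sum>i<Suc N. f i) / Suc N - (\<Sum>i<N. f i) / N\<bar> \<le> 2 / Suc N"
proof (cases "N = 0")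
  case True
  then show ?thesis using assms[of 0] by simp
next
  case False
  have "\<bar>\<Sum>i<N. f i\<bar> \<le> (\<Sum>i<N. \<bar>f i\<bar>)" by (rule sum_abs)
  also have "\<dots> \<le> (\<Sum>i<N. 1)" by (intro sum_mono assms)
  finally have s: "\<bar>\<Sum>i<N. f i\<bar> \<le> N" by simp
  have "(\<Sum>i<Suc N. f i) / Suc N - (\<Sum>i<N. f i) / N = (f N - (\<Sum>i<N. f i) / N) / Suc N"
    using False by (simp add: field_simps)
  moreover have "\<bar>(\<Sum>i<N. f i) / N\<bar> \<le> 1" using s False by (simp add: field_simps)
  then have "\<bar>f N - (\<Sum>i<N. f i) / N\<bar> \<le> 2" using assms[of N] by linarith
  ultimately show ?thesis by (simp add: divide_right_mono del: of_nat_Suc)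
qed

lemma finite_separated:
  fixes V :: "real set"
  assumes "finite V"
  obtains d where "d > 0" "\<And>u v. u \<in> V \<Longrightarrow> v \<in> V \<Longrightarrow> \<bar>u - v\<bar> < d \<Longrightarrow> u = v"
proof
  \<comment> \<open>The extra element \<open>1\<close> keeps \<open>D\<close> nonempty when
    \<open>V\<close> has at most one point.\<close>
  define D where "D = insert 1 ((\<lambda>(u, v). \<bar>u - v\<bar>) ` {p \<in> V \<times> V. fst p \<noteq> snd p})"
  have f: "finite D" using assms by (auto simp: D_def)
  show "Min D > 0" using f by (subst Min_gr_iff) (auto simp: D_def)
  show "u = v" if "u \<in> V" "v \<in> V" "\<bar>u - v\<bar> < Min D" for u v
  proof (rule ccontr)
    assume "u \<noteq> v"
    then have "\<bar>u - v\<bar> \<in> D" using that by (force simp: D_def)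
    then have "Min D \<le> \<bar>u - v\<bar>" using f by simp
    then show False using that by simp
  qed
qed

text \<open>Consecutive averages differ by \<open>O(1/N)\<close>, so they cannot jump between distinct points of \<open>V\<close>.
  The single time \<open>M\<close> determines the limit.\<close>

lemma averages_near_finite_set_converge:
  fixes f :: "'y \<Rightarrow> nat \<Rightarrow> real"
  assumes "finite V"
    and bd: "\<And>y i. y \<in> Y \<Longrightarrow> \<bar>f y i\<bar> \<le> 1"
    and near: "\<And>e. e > 0 \<Longrightarrow> \<exists>N0. \<forall>N\<ge>N0. \<forall>y\<in>Y. \<exists>v\<in>V. \<bar>(\<Sum>i<N. f y i) / N - v\<bar> \<le> e"
  shows "\<exists>c M d. d > 0 \<and> c ` Y \<subseteq> V \<and> (\<forall>u\<in>V. \<forall>v\<in>V. \<bar>u - v\<bar> < 4 * d \<longrightarrow> u = v) \<and>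
    (\<forall>y\<in>Y. \<bar>(\<Sum>i<M. f y i) / M - c y\<bar> \<le> d) \<and>
    uniform_limit Y (\<lambda>N y. (\<Sum>i<N. f y i) / N) c sequentially"
proof -
  obtain d0 where d0: "d0 > 0" "\<And>u v. u \<in> V \<Longrightarrow> v \<in> V \<Longrightarrow> \<bar>u - v\<bar> < d0 \<Longrightarrow> u = v"
    using finite_separated[OF assms(1)] by metis
  \<comment> \<open>The induction step below adds three errors of size at most \<open>d\<close>:
    from \<open>v\<close> to the average at \<open>Suc N\<close>, from there to the average at
    \<open>N\<close>, and from there to \<open>c y\<close>. A separation of \<open>4 * d\<close>
    exceeds their sum.\<close>
  define d where "d = d0 / 4"
  have d: "d > 0" "\<And>u v. u \<in> V \<Longrightarrow> v \<in> V \<Longrightarrow> \<bar>u - v\<bar> < 4 * d \<Longrightarrow> u = v"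
    using d0 by (auto simp: d_def)
  define A where "A N y = (\<Sum>i<N. f y i) / N" for N y
  obtain N0 where N0: "\<And>N y. N \<ge> N0 \<Longrightarrow> y \<in> Y \<Longrightarrow> \<exists>v\<in>V. \<bar>A N y - v\<bar> \<le> d"
    using near[OF d(1)] unfolding A_def by blast
  obtain N1 :: nat where N1: "2 / d < N1" using reals_Archimedean2 by blast
  define M where "M = max N0 N1"
  have "\<forall>y\<in>Y. \<exists>v\<in>V. \<bar>A M y - v\<bar> \<le> d" using N0 by (simp add: M_def)
  then obtain c where c: "\<And>y. y \<in> Y \<Longrightarrow> c y \<in> V" "\<And>y. y \<in> Y \<Longrightarrow> \<bar>A M y - c y\<bar> \<le> d"
    by metis
  have step: "\<bar>A N y - c y\<bar> \<le> d" if NM: "N \<ge> M" and y: "y \<in> Y" for N y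
    using NM
  proof (induction N rule: dec_induct)
    case base
    show ?case using c y by simp
  next
    case (step N)
    obtain v where v: "v \<in> V" "\<bar>A (Suc N) y - v\<bar> \<le> d"
      using N0[of "Suc N" y] step y by (auto simp: M_def)
    have "\<bar>A (Suc N) y - A N y\<bar> \<le> 2 / Suc N"
      unfolding A_def by (rule average_diff_le) (use bd y in auto)
    also have "\<dots> < d"
    proof -
      have "2 / d < Suc N" using N1 step(1) by (simp add: M_def)
      then show ?thesis using d(1) by (simp add: field_simps)
    qed
    finally have "\<bar>v - c y\<bar> < 4 * d" using v(2) step.IH by linarith
    then have "v = c y" using d(2) v c y by auto
    then show ?case using v by simp
  qed
  have "uniform_limit Y A c sequentially"
  proof (rule uniform_limitI)
    fix e :: real assume e: "e > 0"
    define e' where "e' = min d (e/2)"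
    have e': "e' > 0" "e' \<le> d" "e' < e" using e d by (auto simp: e'_def)
    obtain N2 where N2: "\<And>N y. N \<ge> N2 \<Longrightarrow> y \<in> Y \<Longrightarrow> \<exists>v\<in>V. \<bar>A N y - v\<bar> \<le> e'"
      using near[OF e'(1)] unfolding A_def by blast
    have "\<forall>y\<in>Y. dist (A N y) (c y) < e" if N: "N \<ge> max M N2" for N
    proof
      fix y assume y: "y \<in> Y"
      obtain v where v: "v \<in> V" "\<bar>A N y - v\<bar> \<le> e'" using N2 N y by auto
      have "\<bar>A N y - c y\<bar> \<le> d" using step N y by simp
      then have "\<bar>v - c y\<bar> < 4 * d" using v(2) e' d(1) by linarith
      then have "v = c y" using d(2) v c y by auto
      then show "dist (A N y) (c y) < e" using v e' by (simp add: dist_real_def)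
    qed
    then show "\<forall>\<^sub>F N in sequentially. \<forall>y\<in>Y. dist (A N y) (c y) < e"
      unfolding eventually_sequentially by blast
  qed
  moreover have "c ` Y \<subseteq> V" using c by auto
  ultimately show ?thesis
    using d c(2) unfolding A_def[abs_def]
    by (intro exI[of _ c] exI[of _ M] exI[of _ d]) simp
qed

text \<open>Compactness enters through \<open>cpt\<close>: a countable disjoint union of members of
  the algebra that is again a member has only finitely many nonempty terms. Countable additivity of
  the limiting frequencies thus reduces to finite additivity, and Caratheodory extension applies.
  For uniqueness, invariance makes the integral of every nonempty average of \<open>C\<close> equal
  to the measure of \<open>C\<close>, while uniform convergence forces these integrals to the
  limiting frequency.\<close>

lemma unique_invariant_probability:
  fixes T :: "'x \<Rightarrow> 'x"
  assumes alg: "Sigma_Algebra.algebra \<Omega> \<A>" and T: "T ` \<Omega> \<subseteq> \<Omega>" and ne: "\<Omega> \<noteq> {}"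
    and pre: "\<And>C. C \<in> \<A> \<Longrightarrow> T -` C \<inter> \<Omega> \<in> \<A>"
    and cpt: "\<And>A :: nat \<Rightarrow> 'x set. range A \<subseteq> \<A> \<Longrightarrow> disjoint_family A \<Longrightarrow> (\<Union>i. A i) \<in> \<A> \<Longrightarrow>
      \<exists>n. \<forall>i\<ge>n. A i = {}"
    and conv: "\<And>C. C \<in> \<A> \<Longrightarrow>
      \<exists>c. uniform_limit \<Omega> (\<lambda>N y. (\<Sum>i<N. indicat_real C ((T ^^ i) y)) / N) (\<lambda>_. c) sequentially"
  shows "\<exists>!\<mu>. sets \<mu> = sigma_sets \<Omega> \<A> \<and> prob_space \<mu> \<and>
    (\<forall>B\<in>sets \<mu>. emeasure \<mu> (T -` B \<inter> space \<mu>) = emeasure \<mu> B)"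
proof -
  interpret Sigma_Algebra.algebra \<Omega> \<A> by fact
  define avg where "avg C N y = (\<Sum>i<N. indicat_real C ((T ^^ i) y)) / N" for C and N :: nat and y
  have "\<forall>C\<in>\<A>. \<exists>c. uniform_limit \<Omega> (avg C) (\<lambda>_. c) sequentially"
    using conv unfolding avg_def[abs_def] by simp
  then obtain c where c: "\<And>C. C \<in> \<A> \<Longrightarrow> uniform_limit \<Omega> (avg C) (\<lambda>_. c C) sequentially"
    unfolding bchoice_iff by auto
  have lim: "(\<lambda>N. avg C N y) \<longlonglongrightarrow> c C" if "C \<in> \<A>" "y \<in> \<Omega>" for C y
    using c[OF that(1)] that(2) by (rule tendsto_uniform_limitI)
  \<comment> \<open>The limit does not depend on the starting point, so the values of
    \<open>c\<close> can be computed along one orbit.\<close>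
  obtain y0 where y0: "y0 \<in> \<Omega>" using ne by auto
  have Tn: "(T ^^ i) y \<in> \<Omega>" if "y \<in> \<Omega>" for i y
    using that T by (induction i) auto
  have c_nonneg: "c C \<ge> 0" if "C \<in> \<A>" for C
    using lim[OF that y0]
    by (rule tendsto_lowerbound) (auto simp: avg_def intro!: always_eventually sum_nonneg divide_nonneg_nonneg)
  have c_empty: "c {} = 0"
    using lim[OF empty_sets y0] by (simp add: avg_def LIMSEQ_const_iff)
  have c_top: "c \<Omega> = 1"
  proof -
    have "(\<lambda>N. avg \<Omega> N y0) \<longlonglongrightarrow> 1"
      by (rule tendsto_eventually, rule eventually_sequentiallyI[of 1])
        (auto simp: avg_def Tn y0)
    then show ?thesis using lim[OF top y0] LIMSEQ_unique by blast
  qed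
  have c_Un: "c (C \<union> D) = c C + c D" if "C \<in> \<A>" "D \<in> \<A>" "C \<inter> D = {}" for C D
  proof -
    have "avg (C \<union> D) N y0 = avg C N y0 + avg D N y0" for N
      using that(3)
      by (simp add: avg_def indicator_disj_union sum.distrib add_divide_distrib)
    then have "(\<lambda>N. avg (C \<union> D) N y0) \<longlonglongrightarrow> c C + c D"
      using tendsto_add[OF lim[OF that(1) y0] lim[OF that(2) y0]] by simp
    then show ?thesis using lim[of "C \<union> D" y0] that y0 LIMSEQ_unique by blast
  qed
  have c_pre: "c (T -` C \<inter> \<Omega>) = c C" if C: "C \<in> \<A>" for C
  proof -
    \<comment> \<open>Averages of the preimage along \<open>y0\<close> are averages of
      \<open>C\<close> along \<open>T y0\<close>, which have the same limit.\<close>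
    have "avg (T -` C \<inter> \<Omega>) N y0 = avg C N (T y0)" for N
      unfolding avg_def using Tn[OF y0]
      by (simp add: indicator_def funpow_swap1)
    then have "(\<lambda>N. avg (T -` C \<inter> \<Omega>) N y0) \<longlonglongrightarrow> c C"
      using lim[OF C, of "T y0"] T y0 by auto
    then show ?thesis using lim[OF pre[OF C] y0] LIMSEQ_unique by blast
  qed
  let ?f = "\<lambda>C. ennreal (c C)"
  have pos: "positive \<A> ?f" by (simp add: positive_def c_empty)
  have add: "additive \<A> ?f"
    by (auto simp: additive_def c_Un c_nonneg)
  have ca: "countably_additive \<A> ?f"
    unfolding countably_additive_def
  proof (intro allI impI)
    fix A :: "nat \<Rightarrow> 'x set"
    assume A: "range A \<subseteq> \<A>" "disjoint_family A" "(\<Union>i. A i) \<in> \<A>"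
    then obtain n where n: "\<And>i. i \<ge> n \<Longrightarrow> A i = {}" using cpt by blast
    have "i < n" if "x \<in> A i" for x i using n[of i] that by (cases "i < n") auto
    then have e: "(\<Union>i. A i) = (\<Union>i<n. A i)" by blast
    have "(\<Sum>i. ?f (A i)) = (\<Sum>i<n. ?f (A i))"
      by (rule suminf_finite) (auto simp: n c_empty)
    also have "\<dots> = ?f (\<Union>i<n. A i)"
      by (rule additive_sum[OF pos add])
        (use A in \<open>auto intro: disjoint_family_on_mono\<close>)
    finally show "(\<Sum>i. ?f (A i)) = ?f (\<Union>i. A i)" using e by simp
  qed
  obtain m where m: "\<And>C. C \<in> \<A> \<Longrightarrow> m C = ?f C" "measure_space \<Omega> (sigma_sets \<Omega> \<A>) m"
    using caratheodory'[OF pos ca] by blast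
  define \<mu> where "\<mu> = measure_of \<Omega> \<A> m"
  have sub: "\<A> \<subseteq> Pow \<Omega>" by (rule space_closed)
  have sets_\<mu>: "sets \<mu> = sigma_sets \<Omega> \<A>" and space_\<mu>: "space \<mu> = \<Omega>"
    unfolding \<mu>_def using sub by simp_all
  have em: "emeasure \<mu> C = ?f C" if "C \<in> \<A>" for C
  proof -
    have "emeasure \<mu> C = m C"
      by (rule emeasure_measure_of[OF \<mu>_def sub])
        (use m(2) that in \<open>auto simp: measure_space_def sets_\<mu>\<close>)
    then show ?thesis using m(1) that by simp
  qed
  have unique: "M = N"
    if "sets M = sigma_sets \<Omega> \<A>" "sets N = sigma_sets \<Omega> \<A>" "prob_space M"
      "\<And>C. C \<in> \<A> \<Longrightarrow> emeasure M C = emeasure N C" for M N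
  proof (rule measure_eqI_generator_eq[of \<A> \<Omega> M N "\<lambda>_. \<Omega>"])
    show "Int_stable \<A>" by (auto simp: Int_stable_def)
    show "emeasure M \<Omega> \<noteq> \<infinity>" using prob_space.emeasure_le_1[OF that(3), of \<Omega>]
      by (auto simp: top_unique)
  qed (use that sub in auto)
  have prob_\<mu>: "prob_space \<mu>"
    by (rule prob_spaceI) (simp add: space_\<mu> em c_top)
  have T_meas: "T \<in> \<mu> \<rightarrow>\<^sub>M \<mu>"
    by (rule measurable_sigma_sets[OF sets_\<mu> sub])
      (use T pre in \<open>auto simp: space_\<mu> sets_\<mu>\<close>)
  have inv_\<mu>: "emeasure \<mu> (T -` B \<inter> space \<mu>) = emeasure \<mu> B" if "B \<in> sets \<mu>" for B
  proof -
    have "distr \<mu> \<mu> T = \<mu>"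
    proof (rule unique)
      show "prob_space (distr \<mu> \<mu> T)" using prob_\<mu> T_meas by (rule prob_space.prob_space_distr)
      show "emeasure (distr \<mu> \<mu> T) C = emeasure \<mu> C" if "C \<in> \<A>" for C
      proof -
        have "C \<in> sets \<mu>" using that by (auto simp: sets_\<mu>)
        then show ?thesis using that T_meas
          by (simp add: emeasure_distr space_\<mu> em pre c_pre)
      qed
    qed (auto simp: sets_\<mu>)
    then show ?thesis using emeasure_distr[OF T_meas that] by simp
  qed
  have determined: "emeasure \<nu> C = ?f C"
    if \<nu>: "sets \<nu> = sigma_sets \<Omega> \<A>" "prob_space \<nu>"
      "\<forall>B\<in>sets \<nu>. emeasure \<nu> (T -` B \<inter> space \<nu>) = emeasure \<nu> B" and C: "C \<in> \<A>" for \<nu> C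
  proof -
    interpret \<nu>: prob_space \<nu> by fact
    have sp: "space \<nu> = \<Omega>"
      using \<nu>(1) sets_\<mu> space_\<mu> sets_eq_imp_space_eq by metis
    have A: "(T ^^ i) -` C \<inter> \<Omega> \<in> \<A> \<and> emeasure \<nu> ((T ^^ i) -` C \<inter> \<Omega>) = emeasure \<nu> C" for i
    proof (induction i)
      case 0
      have "C \<inter> \<Omega> = C" using C sub by auto
      then show ?case using C by simp
    next
      case (Suc i)
      have e: "(T ^^ Suc i) -` C \<inter> \<Omega> = T -` ((T ^^ i) -` C \<inter> \<Omega>) \<inter> \<Omega>"
        using T by (auto simp: funpow_swap1)
      let ?D = "(T ^^ i) -` C \<inter> \<Omega>"
      have "?D \<in> sets \<nu>" using Suc \<nu>(1) by auto
      then have "emeasure \<nu> (T -` ?D \<inter> \<Omega>) = emeasure \<nu> ?D" using \<nu>(3) sp by metis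
      then show ?case unfolding e using Suc pre by metis
    qed
    have int: "integrable \<nu> (\<lambda>y. indicat_real C ((T ^^ i) y))"
      and ev: "(\<integral>y. indicat_real C ((T ^^ i) y) \<partial>\<nu>) = measure \<nu> C" for i
    proof -
      have B: "(T ^^ i) -` C \<inter> \<Omega> \<in> sets \<nu>" using A \<nu>(1) by auto
      have "integrable \<nu> (indicat_real ((T ^^ i) -` C \<inter> \<Omega>))"
        using B by (intro integrable_real_indicator) (auto simp: less_top[symmetric])
      then show "integrable \<nu> (\<lambda>y. indicat_real C ((T ^^ i) y))"
        by (rule Bochner_Integration.integrable_cong[OF refl, THEN iffD1, rotated]) (auto simp: indicator_def sp)
      have "(\<integral>y. indicat_real C ((T ^^ i) y) \<partial>\<nu>) = (\<integral>y. indicat_real ((T ^^ i) -` C \<inter> \<Omega>) y \<partial>\<nu>)"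
        by (rule Bochner_Integration.integral_cong) (auto simp: indicator_def sp)
      also have "\<dots> = measure \<nu> ((T ^^ i) -` C \<inter> \<Omega>)" using B by (simp add: sp)
      also have "\<dots> = measure \<nu> C" using A by (simp add: measure_def)
      finally show "(\<integral>y. indicat_real C ((T ^^ i) y) \<partial>\<nu>) = measure \<nu> C" .
    qed
    have "\<bar>measure \<nu> C - c C\<bar> \<le> e" if e: "e > 0" for e
    proof -
      have "\<forall>\<^sub>F N in sequentially. \<forall>y\<in>\<Omega>. dist (avg C N y) (c C) < e"
        using uniform_limitD[OF c[OF C] e] .
      then obtain N where N: "\<And>n y. n \<ge> N \<Longrightarrow> y \<in> \<Omega> \<Longrightarrow> dist (avg C n y) (c C) < e"
        unfolding eventually_sequentially by blast
      \<comment> \<open>At least one summand is taken: the empty average is \<open>0\<close> and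
        does not integrate to the measure of \<open>C\<close>.\<close>
      let ?N = "Suc N"
      have i: "integrable \<nu> (avg C ?N)"
        unfolding avg_def using int by auto
      have m: "(\<integral>y. avg C ?N y \<partial>\<nu>) = measure \<nu> C"
        unfolding avg_def using int by (simp add: ev del: sum.lessThan_Suc)
      have "(\<integral>y. avg C ?N y \<partial>\<nu>) \<le> c C + e"
        by (rule \<nu>.integral_le_const[OF i]) (use N[of ?N] in \<open>force simp: dist_real_def sp\<close>)
      moreover have "(\<integral>y. avg C ?N y \<partial>\<nu>) \<ge> c C - e"
        by (rule \<nu>.integral_ge_const[OF i]) (use N[of ?N] in \<open>force simp: dist_real_def sp\<close>)
      ultimately show ?thesis using m by linarith
    qed
    \<comment> \<open>A positive deviation would be bounded by its own half.\<close>
    from this[of "\<bar>measure \<nu> C - c C\<bar> / 2"] have "measure \<nu> C = c C" by force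
    then show ?thesis by (simp add: \<nu>.emeasure_eq_measure)
  qed
  show ?thesis
  proof (rule ex1I[of _ \<mu>])
    show "sets \<mu> = sigma_sets \<Omega> \<A> \<and> prob_space \<mu> \<and>
      (\<forall>B\<in>sets \<mu>. emeasure \<mu> (T -` B \<inter> space \<mu>) = emeasure \<mu> B)"
      using sets_\<mu> prob_\<mu> inv_\<mu> by blast
    fix \<nu> assume \<nu>: "sets \<nu> = sigma_sets \<Omega> \<A> \<and> prob_space \<nu> \<and>
      (\<forall>B\<in>sets \<nu>. emeasure \<nu> (T -` B \<inter> space \<nu>) = emeasure \<nu> B)"
    show "\<nu> = \<mu>"
    proof (rule unique)
      show "emeasure \<nu> C = emeasure \<mu> C" if "C \<in> \<A>" for C
        using determined[of \<nu> C] \<nu> that em by metis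
    qed (use \<nu> sets_\<mu> in blast)+
  qed
qed

text \<open>The maximum over \<open>C\<close> drops by a fixed proportion of the oscillation while the minimum does not
  drop, up to summable errors; so the oscillation is summable.\<close>

lemma oscillation_contraction:
  fixes r :: "nat \<Rightarrow> 's \<Rightarrow> real"
  assumes "finite C" "C \<noteq> {}" "d > 0" and e: "summable e" "\<And>n. e n \<ge> 0"
    and up: "\<And>n s t m. s \<in> C \<Longrightarrow> t \<in> C \<Longrightarrow> (\<And>u. u \<in> C \<Longrightarrow> r n u \<le> m) \<Longrightarrow>
      r (Suc n) s \<le> m - d * (m - r n t) + e n"
    and low: "\<And>n s m. s \<in> C \<Longrightarrow> (\<And>u. u \<in> C \<Longrightarrow> m \<le> r n u) \<Longrightarrow> m - e n \<le> r (Suc n) s"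
  shows "\<exists>c. \<forall>s\<in>C. (\<lambda>n. r n s) \<longlonglongrightarrow> c"
proof -
  define U where "U n = Max (r n ` C)" for n
  define l where "l n = Min (r n ` C)" for n
  have U: "r n s \<le> U n" and l: "l n \<le> r n s" if "s \<in> C" for n s
    unfolding U_def l_def using that assms(1) by auto
  have "U n \<in> r n ` C" "l n \<in> r n ` C" for n
    unfolding U_def l_def by (rule Max_in Min_in; use assms(1,2) in simp)+
  then have U_in: "\<exists>s\<in>C. U n = r n s" and l_in: "\<exists>s\<in>C. l n = r n s" for n
    by blast+
  have lU: "l n \<le> U n" for n using l_in[of n] U by metis
  have U_step: "U (Suc n) \<le> U n - d * (U n - l n) + e n" for n
  proof -
    obtain s where "s \<in> C" "U (Suc n) = r (Suc n) s" using U_in by blast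
    moreover obtain t where "t \<in> C" "l n = r n t" using l_in by blast
    ultimately show ?thesis using up[of s t n "U n"] U by simp
  qed
  have l_step: "l n - e n \<le> l (Suc n)" for n
    using l_in[of "Suc n"] low[of _ "l n" n] l by fastforce
  \<comment> \<open>Each step lowers the gap \<open>U - l\<close> by at least \<open>d\<close> times
    itself, up to \<open>2 * e n\<close>; adding up these steps bounds the sum of all gaps.\<close>
  have partial: "d * (\<Sum>k<n. U k - l k) + (U n - l n) \<le> U 0 - l 0 + 2 * (\<Sum>k<n. e k)" for n
  proof (induction n)
    case (Suc n)
    show ?case using Suc U_step[of n] l_step[of n] by (simp add: distrib_left)
  qed simp
  have osc: "summable (\<lambda>n. U n - l n)"
  proof (rule summableI_nonneg_bounded)
    show "0 \<le> U n - l n" for n using lU by simp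
    show "(\<Sum>k<n. U k - l k) \<le> (U 0 - l 0 + 2 * suminf e) / d" for n
    proof -
      have "(\<Sum>k<n. e k) \<le> suminf e" using e by (intro sum_le_suminf) auto
      then have "d * (\<Sum>k<n. U k - l k) \<le> U 0 - l 0 + 2 * suminf e"
        using partial[of n] lU[of n] by linarith
      then show ?thesis using \<open>d > 0\<close> by (simp add: field_simps)
    qed
  qed
  \<comment> \<open>From below, \<open>U (Suc n)\<close> is at least \<open>l (Suc n)\<close>, hence
    at least \<open>l n - e n\<close>; so an increment of \<open>U\<close> is in absolute value at
    most the gap plus the error.\<close>
  have "summable (\<lambda>n. U (Suc n) - U n)"
  proof (rule summable_comparison_test'[where N = 0])
    show "summable (\<lambda>n. (U n - l n) + e n)" using osc e(1) by (rule summable_add)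
    fix n
    have "d * (U n - l n) \<ge> 0" using \<open>d > 0\<close> lU by simp
    then show "norm (U (Suc n) - U n) \<le> (U n - l n) + e n"
      using U_step[of n] l_step[of n] lU[of "Suc n"] lU[of n] by (simp add: abs_le_iff)
  qed
  then have "convergent (\<lambda>n. \<Sum>k<n. U (Suc k) - U k)"
    by (simp add: summable_iff_convergent)
  then have "convergent (\<lambda>n. U n - U 0)" by (simp add: sum_lessThan_telescope)
  then obtain c0 where "(\<lambda>n. U n - U 0) \<longlonglongrightarrow> c0" by (auto simp: convergent_def)
  from tendsto_add[OF this tendsto_const[of "U 0"]]
  have Uc: "U \<longlonglongrightarrow> c0 + U 0" by simp
  from tendsto_diff[OF Uc summable_LIMSEQ_zero[OF osc]]
  have lc: "l \<longlonglongrightarrow> c0 + U 0" by simp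
  have "(\<lambda>n. r n s) \<longlonglongrightarrow> c0 + U 0" if "s \<in> C" for s
    by (rule tendsto_sandwich[OF _ _ lc Uc]) (use U l that in \<open>auto intro!: always_eventually\<close>)
  then show ?thesis by blast
qed

section \<open>The lifted substitution\<close>

lemma append_eq_append_longer:
  assumes "xs @ ys = zs @ ts" "length zs \<le> length xs"
  shows "\<exists>us. xs = zs @ us \<and> us @ ys = ts"
proof (intro exI conjI)
  show "xs = zs @ drop (length zs) xs"
    using assms by (metis append_eq_append_conv_if append_take_drop_id)
  show "drop (length zs) xs @ ys = ts"
    using assms by (metis append_eq_append_conv_if)
qed

locale skew_substitution = group G for G :: "('g, 'k) monoid_scheme" (structure) +
  fixes \<phi> :: "'a::finite list \<Rightarrow> 'g" and \<tau> :: "'a list \<Rightarrow> 'a list"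
  assumes finite_carrier: "finite (carrier G)"
    and phi_closed [simp]: "\<phi> u \<in> carrier G"
    and phi_append: "\<phi> (u @ v) = \<phi> u \<otimes> \<phi> v"
    and tau_append: "\<tau> (u @ v) = \<tau> u @ \<tau> v"
    and phi_tau: "\<phi> (\<tau> u) = \<phi> u"
begin

lemma phi_Nil [simp]: "\<phi> [] = \<one>"
  using phi_append[of "[]" "[]"] phi_closed[of "[]"] by simp

lemma phi_Cons: "\<phi> (a # v) = \<phi> [a] \<otimes> \<phi> v"
  using phi_append[of "[a]" v] by simp

lemma pow_append: "(\<tau> ^^ n) (u @ v) = (\<tau> ^^ n) u @ (\<tau> ^^ n) v"
  by (induction n) (simp_all add: tau_append)

lemma pow_Nil [simp]: "(\<tau> ^^ n) [] = []"
  using pow_append[of n "[]" "[]"] by simp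

lemma pow_Cons: "(\<tau> ^^ n) (a # v) = (\<tau> ^^ n) [a] @ (\<tau> ^^ n) v"
  using pow_append[of n "[a]" v] by simp

lemma phi_pow [simp]: "\<phi> ((\<tau> ^^ n) u) = \<phi> u"
  by (induction n) (simp_all add: phi_tau)

text \<open>\<open>occ n a h b\<close>: the letter \<open>(g \<otimes> h, b)\<close> occurs in the \<open>n\<close>-th lifted iterate of \<open>(g, a)\<close>, for every \<open>g\<close>.\<close>

definition occ :: "nat \<Rightarrow> 'a \<Rightarrow> 'g \<Rightarrow> 'a \<Rightarrow> bool" where
  "occ n a h b \<longleftrightarrow> (\<exists>u v. (\<tau> ^^ n) [a] = u @ b # v \<and> \<phi> u = h)"

lemma occ_closed: "occ n a h b \<Longrightarrow> h \<in> carrier G"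
  by (auto simp: occ_def)

text \<open>A prefix \<open>u\<close> of the \<open>m\<close>-th iterate becomes
  \<open>(\<tau> ^^ n) u\<close>, and \<open>phi_tau\<close> keeps its value in the group. Hence
  displacements multiply when an occurrence is refined.\<close>

lemma occ_comp:
  assumes "occ m a h b" "occ n b k c"
  shows "occ (m + n) a (h \<otimes> k) c"
proof -
  obtain u v u' v' where "(\<tau> ^^ m) [a] = u @ b # v" "\<phi> u = h" "(\<tau> ^^ n) [b] = u' @ c # v'" "\<phi> u' = k"
    using assms by (auto simp: occ_def)
  then have "(\<tau> ^^ (m + n)) [a] = ((\<tau> ^^ n) u @ u') @ c # (v' @ (\<tau> ^^ n) v)"
    by (subst add.commute) (simp add: funpow_add pow_append pow_Cons[of n b v])
  moreover have "\<phi> ((\<tau> ^^ n) u @ u') = h \<otimes> k"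
    using \<open>\<phi> u = h\<close> \<open>\<phi> u' = k\<close> by (simp add: phi_append)
  ultimately show ?thesis unfolding occ_def by blast
qed

lemma pow_eq_splitD:
  assumes "(\<tau> ^^ n) w = u @ c # v"
  shows "\<exists>w1 b w2 u' v'. w = w1 @ b # w2 \<and> (\<tau> ^^ n) [b] = u' @ c # v' \<and> u = (\<tau> ^^ n) w1 @ u'"
  using assms
proof (induction w arbitrary: u)
  case (Cons a w)
  have eq: "(\<tau> ^^ n) [a] @ (\<tau> ^^ n) w = u @ c # v" using Cons.prems pow_Cons by metis
  show ?case
  proof (cases "length u < length ((\<tau> ^^ n) [a])")
    case True
    then obtain v' where "(\<tau> ^^ n) [a] = u @ c # v'"
      using eq by (auto simp: append_eq_append_conv2 append_eq_Cons_conv)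
    then show ?thesis by (intro exI[of _ "[]"] exI[of _ a] exI[of _ w] exI[of _ u] exI[of _ v']) simp
  next
    case False
    then obtain u0 where u0: "u = (\<tau> ^^ n) [a] @ u0" "(\<tau> ^^ n) w = u0 @ c # v"
      using append_eq_append_longer[OF eq[symmetric]] by force
    from Cons.IH[OF u0(2)] obtain w1 b w2 u' v' where
      "w = w1 @ b # w2" "(\<tau> ^^ n) [b] = u' @ c # v'" "u0 = (\<tau> ^^ n) w1 @ u'" by blast
    then show ?thesis using u0(1) pow_Cons[of n a w1]
      by (intro exI[of _ "a # w1"] exI[of _ b] exI[of _ w2] exI[of _ u'] exI[of _ v']) simp
  qed
qed simp

lemma pow_prefix_split:
  assumes "P @ Q = (\<tau> ^^ n) U" and K: "\<And>a. length ((\<tau> ^^ n) [a]) \<le> K"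
  shows "\<exists>u1 u2 p. U = u1 @ u2 \<and> P = (\<tau> ^^ n) u1 @ p \<and> length p \<le> K"
  using assms(1)
proof (induction U arbitrary: P)
  case (Cons a U)
  have eq: "P @ Q = (\<tau> ^^ n) [a] @ (\<tau> ^^ n) U" using Cons.prems pow_Cons by metis
  show ?case
  proof (cases "length P < length ((\<tau> ^^ n) [a])")
    case True
    then show ?thesis using K[of a] by (intro exI[of _ "[]"] exI[of _ "a # U"] exI[of _ P]) simp
  next
    case False
    then obtain P' where P': "P = (\<tau> ^^ n) [a] @ P'" "P' @ Q = (\<tau> ^^ n) U"
      using append_eq_append_longer[OF eq] by force
    from Cons.IH[OF this(2)] obtain u1 u2 p where
      "U = u1 @ u2" "P' = (\<tau> ^^ n) u1 @ p" "length p \<le> K" by blast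
    then show ?thesis using P'(1) pow_Cons[of n a u1]
      by (intro exI[of _ "a # u1"] exI[of _ u2] exI[of _ p]) simp
  qed
qed simp

text \<open>The cut after \<open>P\<close> falls into one block, and \<open>s\<close> completes that
  block. The equation \<open>P @ s = (\<tau> ^^ n) u1\<close> is kept because it determines the
  group element at which the remaining complete blocks begin.\<close>

lemma pow_suffix_split:
  assumes "P @ Q = (\<tau> ^^ n) U" and K: "\<And>a. length ((\<tau> ^^ n) [a]) \<le> K"
  shows "\<exists>u1 u2 s. U = u1 @ u2 \<and> Q = s @ (\<tau> ^^ n) u2 \<and> P @ s = (\<tau> ^^ n) u1 \<and> length s \<le> K"
  using assms(1)
proof (induction U arbitrary: P)
  case (Cons a U)
  have eq: "P @ Q = (\<tau> ^^ n) [a] @ (\<tau> ^^ n) U" using Cons.prems pow_Cons by metis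
  show ?case
  proof (cases "length P \<le> length ((\<tau> ^^ n) [a])")
    case True
    obtain s where "Q = s @ (\<tau> ^^ n) U" "P @ s = (\<tau> ^^ n) [a]"
      using append_eq_append_longer[OF eq[symmetric] True] by metis
    moreover from this have "length s \<le> K" using K[of a] by (metis length_append le_add2 order_trans)
    ultimately show ?thesis by (intro exI[of _ "[a]"] exI[of _ U] exI[of _ s]) simp
  next
    case False
    then obtain P' where P': "P = (\<tau> ^^ n) [a] @ P'" "P' @ Q = (\<tau> ^^ n) U"
      using append_eq_append_longer[OF eq] by force
    from Cons.IH[OF this(2)] obtain u1 u2 s where
      "U = u1 @ u2" "Q = s @ (\<tau> ^^ n) u2" "P' @ s = (\<tau> ^^ n) u1" "length s \<le> K" by blast
    then show ?thesis using P'(1) pow_Cons[of n a u1]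
      by (intro exI[of _ "a # u1"] exI[of _ u2] exI[of _ s]) simp
  qed
qed simp

lemma occ_split:
  assumes "occ (m + n) a h c"
  shows "\<exists>k b k'. occ m a k b \<and> occ n b k' c \<and> h = k \<otimes> k'"
proof -
  obtain u v where uv: "(\<tau> ^^ (m + n)) [a] = u @ c # v" "\<phi> u = h"
    using assms by (auto simp: occ_def)
  then have "(\<tau> ^^ n) ((\<tau> ^^ m) [a]) = u @ c # v" by (subst (asm) add.commute) (simp add: funpow_add)
  from pow_eq_splitD[OF this] obtain w1 b w2 u' v' where
    "(\<tau> ^^ m) [a] = w1 @ b # w2" "(\<tau> ^^ n) [b] = u' @ c # v'" "u = (\<tau> ^^ n) w1 @ u'" by blast
  moreover from this uv have "h = \<phi> w1 \<otimes> \<phi> u'" by (auto simp: phi_append)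
  ultimately show ?thesis unfolding occ_def by blast
qed

text \<open>By \<open>occ_split\<close> and \<open>occ_comp\<close>, \<open>occ (k + n)\<close> is
  the composition of the labelled relations \<open>occ k\<close> and \<open>occ n\<close>, so it
  depends on \<open>k\<close> only through \<open>occ k\<close>.\<close>

lemma occ_add_cong:
  assumes "occ i = occ j"
  shows "occ (i + n) = occ (j + n)"
proof -
  have "occ (k + n) a h c \<longleftrightarrow> (\<exists>k1 b k2. occ k a k1 b \<and> occ n b k2 c \<and> h = k1 \<otimes> k2)" for k a h c
    using occ_split occ_comp by blast
  then show ?thesis unfolding fun_eq_iff using assms by simp
qed

text \<open>This is the usual idempotent in a finite cyclic semigroup. Only finitely many relations
  \<open>occ n\<close> exist, so they are periodic with some period \<open>d\<close> from some index
  \<open>i\<close> on. The exponent \<open>(i + 1) * d\<close> lies beyond \<open>i\<close> and is a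
  multiple of \<open>d\<close>, so all its positive multiples give the same relation; taking
  \<open>i + 1\<close> instead of \<open>i\<close> keeps it positive.\<close>

lemma idempotent_power:
  obtains q where "q \<ge> 1" "\<And>k. k \<ge> 1 \<Longrightarrow> occ (q * k) = occ q"
proof -
  define E where "E n = {(a, h, b). occ n a h b}" for n
  have "range E \<subseteq> Pow (UNIV \<times> carrier G \<times> UNIV)" by (auto simp: E_def dest: occ_closed)
  then have "finite (range E)"
    by (rule finite_subset) (simp add: finite_carrier)
  then have "\<not> inj E" using finite_imageD by fastforce
  then obtain i j where ij: "i < j" "E i = E j"
    unfolding inj_def by (metis linorder_neqE_nat)
  have occ_ij: "occ i = occ j"
    using ij(2) unfolding E_def fun_eq_iff by (auto simp: set_eq_iff)
  define d where "d = j - i"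
  have d: "d \<ge> 1" "j = i + d" using ij by (auto simp: d_def)
  have per1: "occ (n + d) = occ n" if "n \<ge> i" for n
    using occ_add_cong[OF occ_ij, of "n - i"] that d by (simp add: add.commute)
  have per: "occ (n + k * d) = occ n" if "n \<ge> i" for n k
  proof (induction k)
    case (Suc k)
    have "occ (n + Suc k * d) = occ ((n + k * d) + d)" by (simp add: algebra_simps)
    then show ?case using per1[of "n + k * d"] Suc that by simp
  qed simp
  show ?thesis
  proof
    show "(i + 1) * d \<ge> 1" using d(1) by simp
    fix k :: nat assume "k \<ge> 1"
    then have e: "(i + 1) * d * k = (i + 1) * d + ((k - 1) * (i + 1)) * d"
      by (cases k) (auto simp: algebra_simps)
    have "i \<le> (i + 1) * d" using d(1) by (cases d) auto
    then show "occ ((i + 1) * d * k) = occ ((i + 1) * d)"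
      unfolding e by (rule per)
  qed
qed

end

text \<open>The windows passed to \<open>F\<close> are truncated at the end of the word, so \<open>orbit_sum\<close> is additive under
  concatenation only up to a bounded error.\<close>

primrec orbit_sum ::
  "('g, 'k) monoid_scheme \<Rightarrow> ('a list \<Rightarrow> 'g) \<Rightarrow> nat \<Rightarrow> ('g \<Rightarrow> 'a list \<Rightarrow> real) \<Rightarrow> 'a list \<Rightarrow> 'g \<Rightarrow> real"
where
  "orbit_sum G \<phi> L F [] g = 0"
| "orbit_sum G \<phi> L F (a # v) g = F g (take L (a # v)) + orbit_sum G \<phi> L F v (g \<otimes>\<^bsub>G\<^esub> \<phi> [a])"

text \<open>For the lifted alphabet, \<open>idempotent\<close> says that a state reachable in some
  positive number of steps is reachable in one; \<open>k = 0\<close> is excluded because it yields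
  only the trivial occurrence. The bound \<open>length_ge_2\<close> makes lengths double, which
  later renders the cutting errors summable.\<close>

locale idempotent_skew_substitution = skew_substitution G \<phi> \<tau>
  for G :: "('g, 'k) monoid_scheme" (structure) and \<phi> :: "'a::finite list \<Rightarrow> 'g" and \<tau> +
  assumes positive: "b \<in> set (\<tau> [a])"
    and length_ge_2: "length (\<tau> [a]) \<ge> 2"
    and idempotent: "k \<ge> 1 \<Longrightarrow> occ k = occ 1"
begin

section \<open>Reachability between states and growth of blocks\<close>

lemma reach_ex:
  obtains h where "occ 1 a h b"
  using split_list[OF positive[of b a]] unfolding occ_def by auto

lemma reach_trans: "occ 1 a h b \<Longrightarrow> occ 1 b k c \<Longrightarrow> occ 1 a (h \<otimes> k) c"
  using occ_comp[of 1 a h b 1 k c] idempotent[of "1 + 1"] by simp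

text \<open>Returning from \<open>b\<close> to \<open>a\<close> by some \<open>h'\<close> gives a loop \<open>h \<otimes> h'\<close> at \<open>a\<close>; running through it
  \<open>|G|\<close> times closes up in \<open>G\<close>.\<close>

lemma reach_sym:
  assumes "occ 1 a h b"
  shows "occ 1 b (inv h) a"
proof -
  obtain h' where h': "occ 1 b h' a" by (rule reach_ex)
  define k where "k = h \<otimes> h'"
  have closed: "h \<in> carrier G" "h' \<in> carrier G" "k \<in> carrier G"
    using assms h' by (auto simp: k_def dest: occ_closed)
  have k: "occ 1 a k a" unfolding k_def by (rule reach_trans) fact+
  have pow: "occ 1 b (h' \<otimes> k [^] n) a" for n :: nat
  proof (induction n)
    case 0
    show ?case using h' closed by simp
  next
    case (Suc n)
    show ?case using reach_trans[OF Suc k] closed by (simp add: m_assoc)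
  qed
  define n where "n = Coset.order G - 1"
  have "Coset.order G > 0" using finite_carrier order_gt_0_iff_finite by blast
  then have "k [^] Suc n = \<one>"
    using pow_order_eq_1[OF closed(3)] by (simp add: n_def)
  then have "k \<otimes> k [^] n = \<one>" using closed by (simp only: nat_pow_Suc2)
  then have "h \<otimes> (h' \<otimes> k [^] n) = \<one>" using closed by (simp add: k_def m_assoc)
  then have "h' \<otimes> k [^] n = inv h"
    using closed by (metis inv_equality inv_inv m_closed nat_pow_closed)
  then show ?thesis using pow by metis
qed

lemma reach_refl: "occ 1 a \<one> a"
proof -
  obtain h where h: "occ 1 a h a" by (rule reach_ex)
  then show ?thesis using reach_trans[OF h reach_sym[OF h]] occ_closed[OF h] by simp
qed

lemma length_pow_ge: "2 ^ n * length u \<le> length ((\<tau> ^^ n) u)"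
proof (induction n)
  case (Suc n)
  have "2 * length w \<le> length (\<tau> w)" for w
  proof (induction w)
    case (Cons a w)
    show ?case using Cons length_ge_2[of a] tau_append[of "[a]" w] by simp
  qed simp
  from this[of "(\<tau> ^^ n) u"] Suc show ?case by simp
qed simp

lemma length_pow_pos: "length ((\<tau> ^^ n) [a]) > 0"
proof -
  have "0 < 2 ^ n * length [a]" by simp
  also note length_pow_ge
  finally show ?thesis .
qed

text \<open>Since \<open>\<tau> [b]\<close> contains every letter, the level-\<open>n\<close> block
  of \<open>a\<close> lies inside the level-\<open>Suc n\<close> block of \<open>b\<close>, whose
  length is at most the largest image length times that of the level-\<open>n\<close> block of
  \<open>b\<close>. One further application costs the same factor again. The bound guarantees every
  subblock a fixed share of the block above it.\<close>

lemma length_comparable: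
  obtains K where "K > 0" "\<And>n a b. length ((\<tau> ^^ Suc n) [a]) \<le> K * length ((\<tau> ^^ n) [b])"
proof -
  define K where "K = Max (range (\<lambda>a. length (\<tau> [a])))"
  have K: "length (\<tau> [a]) \<le> K" for a unfolding K_def by simp
  have Kw: "length (\<tau> w) \<le> K * length w" for w
  proof (induction w)
    case Nil
    show ?case using pow_Nil[of 1] by simp
  next
    case (Cons a w)
    show ?case using Cons K[of a] tau_append[of "[a]" w] by simp
  qed
  have "K > 0" using K[of undefined] length_ge_2[of undefined] by linarith
  moreover have "length ((\<tau> ^^ Suc n) [a]) \<le> K * K * length ((\<tau> ^^ n) [b])" for n a b
  proof -
    obtain u v where uv: "\<tau> [b] = u @ a # v" using positive[of a b] by (auto dest: split_list)
    have "(\<tau> ^^ Suc n) [b] = (\<tau> ^^ n) (\<tau> [b])" by (simp add: funpow_swap1)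
    then have "length ((\<tau> ^^ n) [a]) \<le> length ((\<tau> ^^ Suc n) [b])"
      by (simp add: uv pow_append pow_Cons[of n a v])
    also have "\<dots> \<le> K * length ((\<tau> ^^ n) [b])" using Kw by simp
    finally have "K * length ((\<tau> ^^ n) [a]) \<le> K * (K * length ((\<tau> ^^ n) [b]))"
      by (rule mult_le_mono2)
    with Kw[of "(\<tau> ^^ n) [a]"] show ?thesis
      by (simp only: funpow.simps comp_apply mult.assoc)
  qed
  ultimately show ?thesis using that[of "K * K"] by simp
qed

definition reach_class :: "'g \<Rightarrow> 'a \<Rightarrow> ('g \<times> 'a) set" where
  "reach_class g a = {(g \<otimes> h, b) | h b. occ 1 a h b}"

lemma reach_class_closed:
  "g \<in> carrier G \<Longrightarrow> (h, b) \<in> reach_class g a \<Longrightarrow> h \<in> carrier G"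
  by (auto simp: reach_class_def dest: occ_closed)

lemma finite_reach_class: "g \<in> carrier G \<Longrightarrow> finite (reach_class g a)"
  by (rule finite_subset[of _ "carrier G \<times> UNIV"]) (auto simp: finite_carrier dest: reach_class_closed)

lemma reach_class_occ:
  assumes "g \<in> carrier G" "(h, b) \<in> reach_class g a" "occ 1 b k c"
  shows "(h \<otimes> k, c) \<in> reach_class g a"
proof -
  obtain h0 where h0: "h = g \<otimes> h0" "occ 1 a h0 b" using assms(2) by (auto simp: reach_class_def)
  have "h \<otimes> k = g \<otimes> (h0 \<otimes> k)" using h0 assms occ_closed by (simp add: m_assoc)
  then show ?thesis using reach_trans[OF h0(2) assms(3)] by (auto simp: reach_class_def)
qed

text \<open>Going from \<open>b\<close> back to \<open>a\<close> and on to \<open>b'\<close> is a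
  single step by symmetry and transitivity. So every state of the class, in particular one of
  extremal average, occurs in the image of every other; this drives the contraction.\<close>

lemma reach_class_connected:
  assumes g: "g \<in> carrier G" and s: "(h, b) \<in> reach_class g a" and t: "(h', b') \<in> reach_class g a"
  shows "\<exists>u v. \<tau> [b] = u @ b' # v \<and> h \<otimes> \<phi> u = h'"
proof -
  obtain h0 where h0: "h = g \<otimes> h0" "occ 1 a h0 b" using s by (auto simp: reach_class_def)
  obtain h1 where h1: "h' = g \<otimes> h1" "occ 1 a h1 b'" using t by (auto simp: reach_class_def)
  have "occ 1 b (inv h0 \<otimes> h1) b'" using reach_trans[OF reach_sym[OF h0(2)] h1(2)] .
  moreover have "h \<otimes> (inv h0 \<otimes> h1) = h'"
    using h0 h1 occ_closed[OF h0(2)] occ_closed[OF h1(2)] g by (simp add: m_assoc flip: m_assoc[of h0])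
  ultimately show ?thesis by (auto simp: occ_def)
qed

lemma reach_class_self: "g \<in> carrier G \<Longrightarrow> (g, a) \<in> reach_class g a"
  using reach_refl[of a] unfolding reach_class_def by force

end

section \<open>Averages over substituted words\<close>

context idempotent_skew_substitution
begin

abbreviation osum :: "nat \<Rightarrow> ('g \<Rightarrow> 'a list \<Rightarrow> real) \<Rightarrow> 'a list \<Rightarrow> 'g \<Rightarrow> real" where
  "osum \<equiv> orbit_sum G \<phi>"

context
  fixes L :: nat and F :: "'g \<Rightarrow> 'a list \<Rightarrow> real"
  assumes F_bound: "\<And>g w. \<bar>F g w\<bar> \<le> 1"
begin

lemma orbit_sum_abs: "\<bar>osum L F v g\<bar> \<le> length v"
proof (induction v arbitrary: g)
  case (Cons a v)
  show ?case using Cons[of "g \<otimes> \<phi> [a]"] F_bound[of g "take L (a # v)"] by simp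
qed simp

text \<open>Only windows starting in the last \<open>L\<close> letters of \<open>u\<close> can reach
  into \<open>v\<close>, and each of them changes its summand by at most \<open>2\<close>.\<close>

lemma orbit_sum_append:
  assumes "g \<in> carrier G"
  shows "\<bar>osum L F (u @ v) g - osum L F u g - osum L F v (g \<otimes> \<phi> u)\<bar> \<le> 2 * L"
proof -
  \<comment> \<open>The induction needs the minimum: prepending a letter adds an error only while
    \<open>u\<close> is shorter than \<open>L\<close>.\<close>
  have "\<bar>osum L F (u @ v) g - osum L F u g - osum L F v (g \<otimes> \<phi> u)\<bar> \<le> 2 * min (length u) L"
    using assms
  proof (induction u arbitrary: g)
    case (Cons a u)
    have g: "g \<otimes> \<phi> [a] \<in> carrier G" "g \<otimes> \<phi> [a] \<otimes> \<phi> u = g \<otimes> \<phi> (a # u)"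
      using Cons.prems by (auto simp: phi_Cons[of a u] m_assoc)
    have IH: "\<bar>osum L F (u @ v) (g \<otimes> \<phi> [a]) - osum L F u (g \<otimes> \<phi> [a]) - osum L F v (g \<otimes> \<phi> (a # u))\<bar> \<le> 2 * min (length u) L"
      using Cons.IH[OF g(1)] g(2) by simp
    show ?case
    proof (cases "length u < L")
      case True
      have "\<bar>F g (take L (a # u @ v))\<bar> \<le> 1" "\<bar>F g (take L (a # u))\<bar> \<le> 1" by (rule F_bound)+
      then show ?thesis using IH True by (simp only: append_Cons orbit_sum.simps) (simp add: min_def split: if_splits)
    next
      case False
      then have "take L (a # u @ v) = take L (a # u)" by (cases L) auto
      then show ?thesis using IH False by (simp add: min_absorb2)
    qed
  qed simp
  then show ?thesis by linarith
qed

text \<open>Each cut between blocks costs at most \<open>2 * L\<close>. The bound is assumed only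
  for letters of \<open>u\<close> at the group element where they are actually read, because later
  it is known only for states of one class.\<close>

lemma orbit_sum_pow_le:
  fixes c :: real
  assumes "g \<in> carrier G"
    and "\<And>u1 b u2. u = u1 @ b # u2 \<Longrightarrow> osum L F ((\<tau> ^^ n) [b]) (g \<otimes> \<phi> u1) \<le> c * length ((\<tau> ^^ n) [b])"
  shows "osum L F ((\<tau> ^^ n) u) g \<le> c * length ((\<tau> ^^ n) u) + 2 * L * length u"
  using assms
proof (induction u arbitrary: g)
  case (Cons a u)
  have g: "g \<otimes> \<phi> [a] \<in> carrier G" "g \<otimes> \<phi> [a] \<otimes> \<phi> w = g \<otimes> \<phi> (a # w)" for w
    using Cons.prems(1) by (simp_all add: phi_Cons[of a w] m_assoc)
  have "osum L F ((\<tau> ^^ n) u) (g \<otimes> \<phi> [a]) \<le> c * length ((\<tau> ^^ n) u) + 2 * L * length u"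
  proof (rule Cons.IH[OF g(1)])
    fix u1 b u2 assume "u = u1 @ b # u2"
    then show "osum L F ((\<tau> ^^ n) [b]) (g \<otimes> \<phi> [a] \<otimes> \<phi> u1) \<le> c * length ((\<tau> ^^ n) [b])"
      using Cons.prems(2)[of "a # u1" b u2] g(2) by simp
  qed
  moreover have "osum L F ((\<tau> ^^ n) [a]) g \<le> c * length ((\<tau> ^^ n) [a])"
    using Cons.prems(2)[of "[]" a u] Cons.prems(1) by simp
  moreover have "\<bar>osum L F ((\<tau> ^^ n) [a] @ (\<tau> ^^ n) u) g - osum L F ((\<tau> ^^ n) [a]) g - osum L F ((\<tau> ^^ n) u) (g \<otimes> \<phi> [a])\<bar> \<le> 2 * L"
    using orbit_sum_append[OF Cons.prems(1), of "(\<tau> ^^ n) [a]" "(\<tau> ^^ n) u"] by simp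
  ultimately show ?case unfolding pow_Cons[of n a u] by (simp add: algebra_simps)
qed simp

lemma orbit_sum_uminus: "osum L (\<lambda>g w. - F g w) v g = - osum L F v g"
  by (induction v arbitrary: g) auto

end

context
  fixes L :: nat and F :: "'g \<Rightarrow> 'a list \<Rightarrow> real"
  assumes F_bound: "\<And>g w. \<bar>F g w\<bar> \<le> 1"
begin

lemma orbit_sum_pow_ge:
  fixes c :: real
  assumes "g \<in> carrier G"
    and "\<And>u1 b u2. u = u1 @ b # u2 \<Longrightarrow> c * length ((\<tau> ^^ n) [b]) \<le> osum L F ((\<tau> ^^ n) [b]) (g \<otimes> \<phi> u1)"
  shows "c * length ((\<tau> ^^ n) u) - 2 * L * length u \<le> osum L F ((\<tau> ^^ n) u) g"
  using orbit_sum_pow_le[of "\<lambda>g w. - F g w" g u L n "- c"] assms F_bound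
  by (simp add: orbit_sum_uminus)

text \<open>\<open>(\<tau> ^^ Suc n) [b]\<close> is made of level-\<open>n\<close> blocks read at
  states of the same class, and every state \<open>t\<close> of the class is among them. Its block
  occupies at least the share \<open>1 / K\<close> of the length, so a state of small average pulls
  all averages of the next level below the maximum. The cuts cost at most \<open>4 * L\<close> per
  letter of \<open>\<tau> [b]\<close>, that is, at most \<open>4 * L / 2 ^ n\<close> relative to the
  length.\<close>

lemma class_averages_converge:
  assumes g: "g \<in> carrier G"
  shows "\<exists>c. \<forall>(h, b)\<in>reach_class g a. (\<lambda>n. osum L F ((\<tau> ^^ n) [b]) h / length ((\<tau> ^^ n) [b])) \<longlonglongrightarrow> c"
proof -
  obtain K where K: "K > 0" "\<And>n a b. length ((\<tau> ^^ Suc n) [a]) \<le> K * length ((\<tau> ^^ n) [b])"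
    using length_comparable by blast
  define len where "len n b = real (length ((\<tau> ^^ n) [b]))" for n b
  have len_pos: "len n b > 0" for n b unfolding len_def using length_pow_pos by simp
  have len_K: "len (Suc n) b \<le> K * len n b'" for n b b'
    unfolding len_def using K(2)[of n b b'] by (metis of_nat_le_iff of_nat_mult)
  have len_2: "2 ^ n * length (\<tau> [b]) \<le> len (Suc n) b" for n b
    unfolding len_def using length_pow_ge[of n "\<tau> [b]"]
    by (simp add: funpow_swap1 flip: of_nat_le_iff[where 'a = real])
  have len_L: "4 * L * length (\<tau> [b]) \<le> 4 * L * ((1 / 2) ^ n * len (Suc n) b)" for n b
    unfolding of_nat_mult
    by (rule mult_left_mono) (use len_2[of n b] in \<open>simp_all add: field_simps\<close>)
  define r where "r n = (\<lambda>(h, b). osum L F ((\<tau> ^^ n) [b]) h / len n b)" for n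
  have S_r: "osum L F ((\<tau> ^^ n) [b]) h = r n (h, b) * len n b" for n h b
    using len_pos[of n b] by (simp add: r_def)
  have "\<exists>c. \<forall>s\<in>reach_class g a. (\<lambda>n. r n s) \<longlonglongrightarrow> c"
  proof (rule oscillation_contraction[where d = "1 / K" and e = "\<lambda>n. real (4 * L) * (1 / 2) ^ n"])
    show "finite (reach_class g a)" by (rule finite_reach_class[OF g])
    show "reach_class g a \<noteq> {}" using reach_class_self[OF g] by auto
    show "0 < 1 / real K" using K by simp
    show "summable (\<lambda>n. real (4 * L) * (1 / 2) ^ n)" by (intro summable_mult summable_geometric) simp
    show "0 \<le> real (4 * L) * (1 / 2) ^ n" for n by simp
  next
    fix n s t m
    assume st: "s \<in> reach_class g a" "t \<in> reach_class g a" and m: "\<And>u. u \<in> reach_class g a \<Longrightarrow> r n u \<le> m"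
    obtain h b h' b' where s: "s = (h, b)" and t: "t = (h', b')" by (cases s; cases t)
    have h: "h \<in> carrier G" using reach_class_closed[OF g] st s by blast
    \<comment> \<open>The image is cut at an occurrence of the state \<open>t\<close>: the blocks of
      \<open>u\<close> and \<open>v\<close> only get the bound \<open>m\<close>, while the block of
      \<open>b'\<close> contributes its exact average.\<close>
    obtain u v where uv: "\<tau> [b] = u @ b' # v" "h \<otimes> \<phi> u = h'"
      using reach_class_connected[OF g] st s t by metis
    have blocks: "osum L F ((\<tau> ^^ n) [c]) (h \<otimes> \<phi> w1) \<le> m * len n c" if "\<tau> [b] = w1 @ c # w2" for w1 c w2
    proof -
      have "occ 1 b (\<phi> w1) c" using that by (auto simp: occ_def)
      then have "(h \<otimes> \<phi> w1, c) \<in> reach_class g a" using reach_class_occ[OF g] st s by blast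
      then show ?thesis using m len_pos[of n c] by (simp add: S_r)
    qed
    have hu: "h \<otimes> \<phi> (u @ [b']) \<in> carrier G" "h' \<in> carrier G" "h' \<otimes> \<phi> [b'] = h \<otimes> \<phi> (u @ [b'])"
      using h uv by (auto simp: phi_append m_assoc)
    let ?W = "(\<tau> ^^ n)"
    have 1: "osum L F (?W u) h \<le> m * length (?W u) + 2 * L * length u"
      by (rule orbit_sum_pow_le[OF F_bound h]) (use blocks uv in \<open>auto simp: len_def\<close>)
    have 2: "osum L F (?W v) (h \<otimes> \<phi> (u @ [b'])) \<le> m * length (?W v) + 2 * L * length v"
    proof (rule orbit_sum_pow_le[OF F_bound hu(1)])
      fix u1 c u2 assume "v = u1 @ c # u2"
      then have "\<tau> [b] = (u @ b' # u1) @ c # u2" using uv by simp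
      from blocks[OF this] show "osum L F (?W [c]) (h \<otimes> \<phi> (u @ [b']) \<otimes> \<phi> u1) \<le> m * length (?W [c])"
        using h by (simp add: len_def phi_append phi_Cons[of b' u1] m_assoc)
    qed
    have 3: "\<bar>osum L F (?W u @ ?W (b' # v)) h - osum L F (?W u) h - osum L F (?W (b' # v)) h'\<bar> \<le> 2 * L"
      using orbit_sum_append[OF F_bound h, where u = "?W u" and v = "?W (b' # v)"] uv by simp
    have 4: "\<bar>osum L F (?W [b'] @ ?W v) h' - osum L F (?W [b']) h' - osum L F (?W v) (h \<otimes> \<phi> (u @ [b']))\<bar> \<le> 2 * L"
      using orbit_sum_append[OF F_bound hu(2), where u = "?W [b']" and v = "?W v"] hu by simp
    have W: "(\<tau> ^^ Suc n) [b] = ?W u @ ?W [b'] @ ?W v"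
      using uv pow_append[of n u "b' # v"] pow_Cons[of n b' v] by (simp add: funpow_swap1)
    have len_sum: "len (Suc n) b = length (?W u) + len n b' + length (?W v)"
      unfolding len_def W by simp
    \<comment> \<open>The parts \<open>u\<close> and \<open>v\<close> cost \<open>2 * L\<close> per
      letter and the two cuts around \<open>b'\<close> cost \<open>4 * L\<close>; since
      \<open>b'\<close> is itself a letter of \<open>\<tau> [b]\<close>, the total is at most
      \<open>4 * L\<close> per letter.\<close>
    have "osum L F ((\<tau> ^^ Suc n) [b]) h \<le> m * (len (Suc n) b - len n b') + r n t * len n b' + 4 * L * length (\<tau> [b])"
    proof -
      have "osum L F ((\<tau> ^^ Suc n) [b]) h \<le> m * (len (Suc n) b - len n b') + r n t * len n b'
          + (2 * L * length u + 2 * L * length v + 4 * L)"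
        using 1 2 3 4 unfolding W pow_Cons[of n b' v] t S_r len_sum by (simp add: algebra_simps)
      moreover have "2 * L * length u + 2 * L * length v + 4 * L \<le> 4 * L * length (\<tau> [b])"
        unfolding uv(1) by (simp add: algebra_simps)
      ultimately show ?thesis by linarith
    qed
    also have "\<dots> = m * len (Suc n) b - (m - r n t) * len n b' + 4 * L * length (\<tau> [b])"
      by (simp add: algebra_simps)
    also have "\<dots> \<le> m * len (Suc n) b - (m - r n t) * (len (Suc n) b / K) + 4 * L * ((1 / 2) ^ n * len (Suc n) b)"
    proof -
      have "len (Suc n) b / K \<le> len n b'" using len_K[of n b b'] K(1) by (simp add: field_simps)
      moreover have "m - r n t \<ge> 0" using m st by simp
      ultimately have "(m - r n t) * (len (Suc n) b / K) \<le> (m - r n t) * len n b'"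
        by (rule mult_left_mono)
      then show ?thesis using len_L[of b n] by linarith
    qed
    also have "\<dots> = (m - 1 / K * (m - r n t) + 4 * L * (1 / 2) ^ n) * len (Suc n) b"
      by (simp add: algebra_simps diff_divide_distrib)
    finally show "r (Suc n) s \<le> m - 1 / K * (m - r n t) + 4 * L * (1 / 2) ^ n"
      unfolding s S_r using len_pos[of "Suc n" b] by (simp add: mult_le_cancel_right)
  next
    fix n s m
    assume s': "s \<in> reach_class g a" and m: "\<And>u. u \<in> reach_class g a \<Longrightarrow> m \<le> r n u"
    obtain h b where s: "s = (h, b)" by (cases s)
    have h: "h \<in> carrier G" using reach_class_closed[OF g] s' s by blast
    have "m * length ((\<tau> ^^ n) (\<tau> [b])) - 2 * L * length (\<tau> [b]) \<le> osum L F ((\<tau> ^^ n) (\<tau> [b])) h"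
    proof (rule orbit_sum_pow_ge[OF h])
      fix w1 c w2 assume "\<tau> [b] = w1 @ c # w2"
      then have "occ 1 b (\<phi> w1) c" by (auto simp: occ_def)
      then have "(h \<otimes> \<phi> w1, c) \<in> reach_class g a" using reach_class_occ[OF g] s' s by blast
      then show "m * length ((\<tau> ^^ n) [c]) \<le> osum L F ((\<tau> ^^ n) [c]) (h \<otimes> \<phi> w1)"
        using m len_pos[of n c] by (simp add: S_r flip: len_def)
    qed
    then have "m * len (Suc n) b - 2 * L * length (\<tau> [b]) \<le> r (Suc n) s * len (Suc n) b"
      unfolding s S_r[symmetric] by (simp add: len_def funpow_swap1)
    moreover have "2 * L * length (\<tau> [b]) \<le> 4 * L * length (\<tau> [b])" by simp
    ultimately have "(m - 4 * L * (1 / 2) ^ n) * len (Suc n) b \<le> r (Suc n) s * len (Suc n) b"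
      using len_L[of b n] unfolding left_diff_distrib mult.assoc by linarith
    then show "m - 4 * L * (1 / 2) ^ n \<le> r (Suc n) s"
      using len_pos[of "Suc n" b] by (simp add: mult_le_cancel_right)
  qed
  then show ?thesis by (simp add: r_def len_def case_prod_unfold)
qed

text \<open>The candidates are the limits attached to the classes, finitely many because there are
  finitely many states. The level \<open>n\<close> depends only on \<open>e\<close>, whereas
  \<open>k\<close> may vary with the word. The level-\<open>n\<close> blocks inside \<open>w\<close>
  are placed along \<open>(\<tau> ^^ k) [c]\<close>, and for \<open>k \<ge> 1\<close> the relation
  \<open>occ k\<close> equals \<open>occ 1\<close>; this is why their states share one class
  whatever \<open>k\<close> is.\<close>

lemma averages_near_finite_set:
  "\<exists>V :: real set. finite V \<and> (\<forall>e :: real. e > 0 \<longrightarrow> (\<exists>N0. \<forall>w g. length w \<ge> N0 \<longrightarrow> g \<in> carrier G \<longrightarrow>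
    (\<forall>n. \<exists>k\<ge>1. \<exists>c. sublist w ((\<tau> ^^ (n + k)) [c])) \<longrightarrow>
    (\<exists>v\<in>V. \<bar>osum L F w g - v * length w\<bar> \<le> e * length w)))"
proof -
  have "\<forall>s\<in>carrier G \<times> UNIV. \<exists>c. \<forall>(h, b)\<in>reach_class (fst s) (snd s).
      (\<lambda>n. osum L F ((\<tau> ^^ n) [b]) h / length ((\<tau> ^^ n) [b])) \<longlonglongrightarrow> c"
    using class_averages_converge by auto
  then obtain c0 where "\<forall>s\<in>carrier G \<times> UNIV. \<forall>(h, b)\<in>reach_class (fst s) (snd s).
      (\<lambda>n. osum L F ((\<tau> ^^ n) [b]) h / length ((\<tau> ^^ n) [b])) \<longlonglongrightarrow> c0 s"
    unfolding bchoice_iff by auto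
  then have c0: "(\<lambda>n. osum L F ((\<tau> ^^ n) [b]) h / length ((\<tau> ^^ n) [b])) \<longlonglongrightarrow> c0 (g, a)"
    if "g \<in> carrier G" "(h, b) \<in> reach_class g a" for g a h b using that by fastforce
  define V where "V = c0 ` (carrier G \<times> UNIV)"
  have fin: "finite V" using finite_carrier by (simp add: V_def)
  have main: "\<exists>N0. \<forall>w g. length w \<ge> N0 \<longrightarrow> g \<in> carrier G \<longrightarrow>
    (\<forall>n. \<exists>k\<ge>1. \<exists>c. sublist w ((\<tau> ^^ (n + k)) [c])) \<longrightarrow>
    (\<exists>v\<in>V. \<bar>osum L F w g - v * length w\<bar> \<le> e * length w)" if e: "e > 0" for e :: real
  proof -
    have "\<forall>\<^sub>F n in sequentially. \<forall>s\<in>carrier G \<times> UNIV. \<forall>t\<in>reach_class (fst s) (snd s).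
      \<bar>osum L F ((\<tau> ^^ n) [snd t]) (fst t) / length ((\<tau> ^^ n) [snd t]) - c0 s\<bar> < e / 4"
    proof (intro eventually_ball_finite ballI)
      fix s t assume "s \<in> carrier G \<times> (UNIV :: 'a set)" "t \<in> reach_class (fst s) (snd s)"
      then have "(\<lambda>n. osum L F ((\<tau> ^^ n) [snd t]) (fst t) / length ((\<tau> ^^ n) [snd t])) \<longlonglongrightarrow> c0 s"
        using c0[of "fst s" "fst t" "snd t" "snd s"] by auto
      from tendstoD[OF this, of "e / 4"] e
      show "\<forall>\<^sub>F n in sequentially.
        \<bar>osum L F ((\<tau> ^^ n) [snd t]) (fst t) / length ((\<tau> ^^ n) [snd t]) - c0 s\<bar> < e / 4"
        by (simp add: dist_real_def)
    qed (auto simp: finite_carrier finite_reach_class)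
    \<comment> \<open>A level-\<open>n\<close> block has at least \<open>2 ^ n\<close> letters, so
      the cost of \<open>2 * L\<close> per block becomes smaller than \<open>e / 4\<close> per
      letter.\<close>
    moreover have "\<forall>\<^sub>F n in sequentially. 2 * L * (1 / 2) ^ n < e / 4"
    proof -
      have "(\<lambda>n. 2 * L * (1 / 2 :: real) ^ n) \<longlonglongrightarrow> real (2 * L) * 0"
        by (intro tendsto_mult_left LIMSEQ_power_zero) simp
      from order_tendstoD(2)[OF this, of "e / 4"] e show ?thesis by simp
    qed
    ultimately have "\<forall>\<^sub>F n in sequentially. (\<forall>s\<in>carrier G \<times> UNIV. \<forall>t\<in>reach_class (fst s) (snd s).
      \<bar>osum L F ((\<tau> ^^ n) [snd t]) (fst t) / length ((\<tau> ^^ n) [snd t]) - c0 s\<bar> < e / 4) \<and>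
      2 * L * (1 / 2) ^ n < e / 4" by (rule eventually_conj)
    then obtain n where n: "\<And>g a h b. g \<in> carrier G \<Longrightarrow> (h, b) \<in> reach_class g a \<Longrightarrow>
        \<bar>osum L F ((\<tau> ^^ n) [b]) h / length ((\<tau> ^^ n) [b]) - c0 (g, a)\<bar> < e / 4"
      and nL: "2 * L * (1 / 2) ^ n < e / 4"
      unfolding eventually_sequentially by fastforce
    define K where "K = Max (range (\<lambda>a. length ((\<tau> ^^ n) [a])))"
    have K: "length ((\<tau> ^^ n) [a]) \<le> K" for a unfolding K_def by simp
    \<comment> \<open>The incomplete blocks at the two ends cost \<open>2 * K\<close> in the sum and
      \<open>2 * K\<close> in \<open>v\<close> times the length, and the two cuts cost
      \<open>4 * L\<close>.\<close>
    obtain N1 :: nat where N1: "(4 * K + 4 * L) / (e / 2) < N1" using reals_Archimedean2 by blast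
    show ?thesis
    proof (intro exI[of _ "max K N1"] allI impI)
      fix w g
      assume w: "max K N1 \<le> length w" and g: "g \<in> carrier G"
        and lang: "\<forall>n. \<exists>k\<ge>1. \<exists>c. sublist w ((\<tau> ^^ (n + k)) [c])"
      obtain k a where k: "k \<ge> 1" "sublist w ((\<tau> ^^ (n + k)) [a])" using lang by blast
      define U where "U = (\<tau> ^^ k) [a]"
      obtain P Q where "P @ (w @ Q) = (\<tau> ^^ n) U"
        using k(2) by (auto simp: sublist_def U_def funpow_add)
      from pow_suffix_split[OF this K] obtain u1 u2 s where
        u1: "U = u1 @ u2" "w @ Q = s @ (\<tau> ^^ n) u2" "P @ s = (\<tau> ^^ n) u1" "length s \<le> K" by blast
      obtain w' where w': "w = s @ w'" "w' @ Q = (\<tau> ^^ n) u2"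
        using append_eq_append_longer[OF u1(2)] u1(4) w by auto
      from pow_prefix_split[OF w'(2) K] obtain u u3 p where
        u: "u2 = u @ u3" "w' = (\<tau> ^^ n) u @ p" "length p \<le> K" by blast
      \<comment> \<open>This is the group element from which reading \<open>P\<close> leads to
        \<open>g\<close>, hence the one at the start of \<open>(\<tau> ^^ n) U\<close>. Since
        iterates of \<open>\<tau>\<close> preserve \<open>\<phi>\<close>, the blocks can be located
        by reading \<open>U\<close> itself from \<open>h\<close>.\<close>
      define h where "h = g \<otimes> inv (\<phi> P)"
      have h: "h \<in> carrier G" using g by (simp add: h_def)
      have "\<phi> P \<otimes> \<phi> s = \<phi> u1" using u1(3) by (metis phi_append phi_pow)
      moreover have "inv (\<phi> P) \<otimes> (\<phi> P \<otimes> \<phi> s) = \<phi> s" by (simp flip: m_assoc)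
      ultimately have gs: "g \<otimes> \<phi> s = h \<otimes> \<phi> u1"
        using g by (simp add: h_def m_assoc)
      define v where "v = c0 (h, a)"
      have "v \<in> V" using h by (simp add: V_def v_def)
      have "\<bar>v\<bar> \<le> 1"
      proof (rule tendsto_upperbound)
        show "(\<lambda>n. \<bar>osum L F ((\<tau> ^^ n) [a]) h / length ((\<tau> ^^ n) [a])\<bar>) \<longlonglongrightarrow> \<bar>v\<bar>"
          unfolding v_def by (intro tendsto_rabs c0 h reach_class_self)
        show "\<forall>\<^sub>F n in sequentially. \<bar>osum L F ((\<tau> ^^ n) [a]) h / length ((\<tau> ^^ n) [a])\<bar> \<le> 1"
          using orbit_sum_abs[OF F_bound] length_pow_pos
          by (intro always_eventually allI) (simp add: divide_le_eq_1)
      qed simp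
      have blocks: "\<bar>osum L F ((\<tau> ^^ n) [b]) (g \<otimes> \<phi> s \<otimes> \<phi> x1) - v * length ((\<tau> ^^ n) [b])\<bar>
          \<le> e / 4 * length ((\<tau> ^^ n) [b])" if "u = x1 @ b # x2" for x1 b x2
      proof -
        have "U = (u1 @ x1) @ b # (x2 @ u3)" using that u u1 by simp
        then have "occ k a (\<phi> (u1 @ x1)) b" unfolding occ_def U_def by blast
        then have "occ 1 a (\<phi> (u1 @ x1)) b" using idempotent[OF k(1)] by simp
        then have "(h \<otimes> \<phi> (u1 @ x1), b) \<in> reach_class h a" by (auto simp: reach_class_def)
        then have "(g \<otimes> \<phi> s \<otimes> \<phi> x1, b) \<in> reach_class h a"
          using h by (simp add: gs phi_append m_assoc)
        from n[OF h this] have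
          "\<bar>osum L F ((\<tau> ^^ n) [b]) (g \<otimes> \<phi> s \<otimes> \<phi> x1) / length ((\<tau> ^^ n) [b]) - v\<bar> * length ((\<tau> ^^ n) [b])
            \<le> e / 4 * length ((\<tau> ^^ n) [b])"
          unfolding v_def by (intro mult_right_mono) auto
        also have "\<bar>osum L F ((\<tau> ^^ n) [b]) (g \<otimes> \<phi> s \<otimes> \<phi> x1) / length ((\<tau> ^^ n) [b]) - v\<bar> * length ((\<tau> ^^ n) [b])
            = \<bar>(osum L F ((\<tau> ^^ n) [b]) (g \<otimes> \<phi> s \<otimes> \<phi> x1) / length ((\<tau> ^^ n) [b]) - v) * length ((\<tau> ^^ n) [b])\<bar>"
          by (simp add: abs_mult)
        also have "(osum L F ((\<tau> ^^ n) [b]) (g \<otimes> \<phi> s \<otimes> \<phi> x1) / length ((\<tau> ^^ n) [b]) - v) * length ((\<tau> ^^ n) [b])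
            = osum L F ((\<tau> ^^ n) [b]) (g \<otimes> \<phi> s \<otimes> \<phi> x1) - v * length ((\<tau> ^^ n) [b])"
          using length_pow_pos[of n b] by (simp add: left_diff_distrib)
        finally show ?thesis .
      qed
      have gs': "g \<otimes> \<phi> s \<in> carrier G" using g by simp
      let ?W = "(\<tau> ^^ n) u"
      have up: "osum L F ?W (g \<otimes> \<phi> s) \<le> (v + e / 4) * length ?W + 2 * L * length u"
      proof (rule orbit_sum_pow_le[OF F_bound gs'])
        fix x1 b x2 assume "u = x1 @ b # x2"
        from blocks[OF this]
        show "osum L F ((\<tau> ^^ n) [b]) (g \<otimes> \<phi> s \<otimes> \<phi> x1) \<le> (v + e / 4) * length ((\<tau> ^^ n) [b])"
          unfolding distrib_right by linarith
      qed
      have lo: "(v - e / 4) * length ?W - 2 * L * length u \<le> osum L F ?W (g \<otimes> \<phi> s)"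
      proof (rule orbit_sum_pow_ge[OF gs'])
        fix x1 b x2 assume "u = x1 @ b # x2"
        from blocks[OF this]
        show "(v - e / 4) * length ((\<tau> ^^ n) [b]) \<le> osum L F ((\<tau> ^^ n) [b]) (g \<otimes> \<phi> s \<otimes> \<phi> x1)"
          unfolding left_diff_distrib by linarith
      qed
      have Lu: "2 * L * length u \<le> e / 4 * length ?W"
      proof -
        have "real (length u) \<le> (1 / 2) ^ n * length ?W"
          using length_pow_ge[of n u] by (simp add: field_simps flip: of_nat_le_iff[where 'a = real])
        then have "2 * L * length u \<le> 2 * L * ((1 / 2) ^ n * length ?W)"
          unfolding of_nat_mult by (intro mult_left_mono) simp_all
        also have "\<dots> = 2 * L * (1 / 2) ^ n * length ?W" by simp
        also have "\<dots> \<le> e / 4 * length ?W" using nL by (intro mult_right_mono) auto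
        finally show ?thesis .
      qed
      have 1: "\<bar>osum L F w g - osum L F s g - osum L F (?W @ p) (g \<otimes> \<phi> s)\<bar> \<le> 2 * L"
        using orbit_sum_append[OF F_bound g, where u = s and v = "?W @ p"] w' u by simp
      have 2: "\<bar>osum L F (?W @ p) (g \<otimes> \<phi> s) - osum L F ?W (g \<otimes> \<phi> s) - osum L F p (g \<otimes> \<phi> s \<otimes> \<phi> ?W)\<bar> \<le> 2 * L"
        using orbit_sum_append[OF F_bound gs', where u = ?W and v = p] .
      have 3: "\<bar>osum L F s g\<bar> \<le> K" "\<bar>osum L F p (g \<otimes> \<phi> s \<otimes> \<phi> ?W)\<bar> \<le> K"
        using orbit_sum_abs[where F = F and v = s and g = g and L = L, OF F_bound]
          orbit_sum_abs[where F = F and v = p and g = "g \<otimes> \<phi> s \<otimes> \<phi> ?W" and L = L, OF F_bound]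
          u1(4) u(3) by linarith+
      have len: "length w = length s + length ?W + length p" using w' u by simp
      have 4: "\<bar>v * length s\<bar> \<le> K" "\<bar>v * length p\<bar> \<le> K"
        using mult_mono[OF \<open>\<bar>v\<bar> \<le> 1\<close>, of "length s" K] mult_mono[OF \<open>\<bar>v\<bar> \<le> 1\<close>, of "length p" K] u1(4) u(3)
        by (simp_all add: abs_mult)
      have 5: "e / 2 * length ?W \<le> e / 2 * length w" using e len by simp
      have 6: "4 * K + 4 * L \<le> e / 2 * length w"
      proof -
        have "(4 * K + 4 * L) / (e / 2) \<le> length w" using N1 w by linarith
        then show ?thesis using e by (simp add: field_simps)
      qed
      have "\<bar>osum L F ?W (g \<otimes> \<phi> s) - v * length ?W\<bar> \<le> e / 2 * length ?W"
        using up lo Lu unfolding distrib_right left_diff_distrib by linarith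
      moreover have "v * length w = v * length s + v * length ?W + v * length p"
        by (simp add: len algebra_simps)
      ultimately have "\<bar>osum L F w g - v * length w\<bar> \<le> e / 2 * length w + (4 * K + 4 * L)"
        using 1 2 3 4 5 by linarith
      then have "\<bar>osum L F w g - v * length w\<bar> \<le> e * length w" using 6 by linarith
      then show "\<exists>v\<in>V. \<bar>osum L F w g - v * length w\<bar> \<le> e * length w" using \<open>v \<in> V\<close> by blast
    qed
  qed
  show ?thesis by (intro exI[of _ V] conjI allI impI fin main)
qed

end
end

section \<open>Cylinders in the skew product\<close>

definition window :: "(int \<Rightarrow> 'a) \<Rightarrow> nat \<Rightarrow> 'a list" where
  "window x N = map (\<lambda>i. x (int i)) [0..<N]"

lemma length_window [simp]: "length (window x N) = N"
  by (simp add: window_def)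

lemma window_Suc: "window x (Suc N) = x 0 # window (shift_map x) N"
  by (simp add: window_def shift_map_def upt_conv_Cons flip: map_Suc_upt del: upt_Suc)
    (simp add: add.commute)

lemma take_window: "take L (window x N) = window x (min L N)"
  by (simp add: window_def take_map min_def)

text \<open>Windows of the infinite point are never truncated, those of the finite word are; the two
  can differ only at the last \<open>L\<close> positions.\<close>

lemma birkhoff_sum_orbit_sum:
  fixes F :: "'g \<Rightarrow> 'a list \<Rightarrow> real"
  assumes F: "\<And>g w. \<bar>F g w\<bar> \<le> 1"
  shows "\<bar>(\<Sum>i<N. case (skew_map G \<phi> ^^ i) (g, x) of (h, z) \<Rightarrow> F h (window z L))
    - orbit_sum G \<phi> L F (window x N) g\<bar> \<le> 2 * L"
proof -
  have "\<bar>(\<Sum>i<N. case (skew_map G \<phi> ^^ i) (g, x) of (h, z) \<Rightarrow> F h (window z L))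
    - orbit_sum G \<phi> L F (window x N) g\<bar> \<le> 2 * min N L"
  proof (induction N arbitrary: g x)
    case (Suc N)
    let ?g = "g \<otimes>\<^bsub>G\<^esub> \<phi> [x 0]" and ?x = "shift_map x"
    have sum: "(\<Sum>i<Suc N. case (skew_map G \<phi> ^^ i) (g, x) of (h, z) \<Rightarrow> F h (window z L)) =
      F g (window x L) + (\<Sum>i<N. case (skew_map G \<phi> ^^ i) (?g, ?x) of (h, z) \<Rightarrow> F h (window z L))"
      by (subst sum.lessThan_Suc_shift) (simp add: funpow_swap1 skew_map_def del: funpow.simps(2) add: funpow_Suc_right)
    have orb: "orbit_sum G \<phi> L F (window x (Suc N)) g =
      F g (window x (min L (Suc N))) + orbit_sum G \<phi> L F (window ?x N) ?g"
      by (simp add: window_Suc flip: take_window)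
    have "\<bar>F g (window x L)\<bar> \<le> 1" "\<bar>F g (window x (min L (Suc N)))\<bar> \<le> 1" by (rule F)+
    then show ?case using Suc.IH[of ?g ?x] unfolding sum orb
      by (cases "L \<le> N") (auto simp: min_def split: if_splits)
  qed (simp add: window_def)
  then show ?thesis by linarith
qed

lemma sum_shift_diff:
  fixes h :: "nat \<Rightarrow> real"
  assumes "\<And>i. \<bar>h i\<bar> \<le> 1"
  shows "\<bar>(\<Sum>i<N. h i) - (\<Sum>i<N. h (i + n))\<bar> \<le> 2 * n"
proof (induction n)
  case (Suc n)
  have "(\<Sum>i<N. h (i + Suc n)) = (\<Sum>i<N. h (i + n)) + h (N + n) - h n"
    using sum.lessThan_Suc_shift[of "\<lambda>i. h (i + n)" N] by simp
  then show ?case using Suc assms[of n] assms[of "N + n"] by simp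
qed simp

section \<open>Topology and Borel sets through agreement on central windows\<close>

definition agree :: "nat \<Rightarrow> 'g \<times> (int \<Rightarrow> 'a) \<Rightarrow> 'g \<times> (int \<Rightarrow> 'a) \<Rightarrow> bool" where
  "agree n y y' \<longleftrightarrow> fst y = fst y' \<and> (\<forall>i. \<bar>i\<bar> \<le> int n \<longrightarrow> snd y i = snd y' i)"

lemma agree_refl [simp]: "agree n y y"
  and agree_sym: "agree n y y' \<Longrightarrow> agree n y' y"
  and agree_trans: "agree n y y' \<Longrightarrow> agree n y' z \<Longrightarrow> agree n y z"
  and agree_mono: "agree m y y' \<Longrightarrow> n \<le> m \<Longrightarrow> agree n y y'"
  by (auto simp: agree_def)

lemma agree_skew_map: "agree (Suc n) y y' \<Longrightarrow> agree n (skew_map G \<phi> y) (skew_map G \<phi> y')"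
  by (auto simp: agree_def skew_map_def shift_map_def split: prod.splits)

lemma agree_skew_map_pow:
  "agree (n + i) y y' \<Longrightarrow> agree n ((skew_map G \<phi> ^^ i) y) ((skew_map G \<phi> ^^ i) y')"
proof (induction i arbitrary: n)
  case (Suc i)
  then show ?case using agree_skew_map[OF Suc.IH[of "Suc n"]] by simp
qed simp

lemma openin_full_shift:
  "openin full_shift_topology V \<longleftrightarrow>
    (\<forall>x\<in>V. \<exists>n. \<forall>x'. (\<forall>i. \<bar>i\<bar> \<le> int n \<longrightarrow> x' i = x i) \<longrightarrow> x' \<in> V)"
proof
  assume V: "openin full_shift_topology V"
  show "\<forall>x\<in>V. \<exists>n. \<forall>x'. (\<forall>i. \<bar>i\<bar> \<le> int n \<longrightarrow> x' i = x i) \<longrightarrow> x' \<in> V"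
  proof
    fix x assume "x \<in> V"
    then obtain U where U: "finite {i. U i \<noteq> UNIV}" "x \<in> Pi\<^sub>E UNIV U" "Pi\<^sub>E UNIV U \<subseteq> V"
      using V unfolding full_shift_topology_def openin_product_topology_alt by auto
    define n where "n = Max (insert 0 ((\<lambda>i. nat \<bar>i\<bar>) ` {i. U i \<noteq> UNIV}))"
    have n: "\<bar>i\<bar> \<le> int n" if "U i \<noteq> UNIV" for i
    proof -
      have "nat \<bar>i\<bar> \<le> n" unfolding n_def using U(1) that by (intro Max_ge) auto
      then show ?thesis by linarith
    qed
    have "x' \<in> V" if "\<forall>i. \<bar>i\<bar> \<le> int n \<longrightarrow> x' i = x i" for x'
    proof -
      have "x' i \<in> U i" for i using n[of i] that U(2) by (cases "U i = UNIV") (auto simp: PiE_def Pi_def)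
      then show ?thesis using U(3) by (auto simp: PiE_def)
    qed
    then show "\<exists>n. \<forall>x'. (\<forall>i. \<bar>i\<bar> \<le> int n \<longrightarrow> x' i = x i) \<longrightarrow> x' \<in> V" by blast
  qed
next
  assume *: "\<forall>x\<in>V. \<exists>n. \<forall>x'. (\<forall>i. \<bar>i\<bar> \<le> int n \<longrightarrow> x' i = x i) \<longrightarrow> x' \<in> V"
  show "openin full_shift_topology V"
    unfolding full_shift_topology_def openin_product_topology_alt
  proof
    fix x assume "x \<in> V"
    then obtain n where n: "\<And>x'. (\<forall>i. \<bar>i\<bar> \<le> int n \<longrightarrow> x' i = x i) \<Longrightarrow> x' \<in> V" using * by blast
    let ?U = "\<lambda>i. if \<bar>i\<bar> \<le> int n then {x i} else UNIV"
    have "finite {i. \<bar>i\<bar> \<le> int n}"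
      by (rule finite_subset[of _ "{- int n..int n}"]) auto
    then have "finite {i. ?U i \<noteq> UNIV}" by (rule rev_finite_subset) auto
    moreover have "Pi\<^sub>E UNIV ?U \<subseteq> V" by (auto intro!: n simp: PiE_def Pi_def split: if_splits)
    moreover have "x \<in> Pi\<^sub>E UNIV ?U" by auto
    ultimately show "\<exists>U. finite {i \<in> UNIV. U i \<noteq> topspace (discrete_topology UNIV)} \<and>
      (\<forall>i\<in>UNIV. openin (discrete_topology UNIV) (U i)) \<and> x \<in> Pi\<^sub>E UNIV U \<and> Pi\<^sub>E UNIV U \<subseteq> V"
      by (intro exI[of _ ?U]) simp
  qed
qed

lemma topspace_full_shift [simp]: "topspace full_shift_topology = UNIV"
  by (simp add: full_shift_topology_def)

text \<open>In the discrete group factor a neighbourhood may be taken to be a point, and in the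
  shift factor a central window; the classes of \<open>agree n\<close> within \<open>Y\<close>
  therefore form a neighbourhood base.\<close>

lemma openin_skew_subtopology:
  assumes Y: "Y \<subseteq> carrier G \<times> X"
  shows "openin (subtopology (skew_topology G X) Y) U \<longleftrightarrow>
    U \<subseteq> Y \<and> (\<forall>y\<in>U. \<exists>n. \<forall>y'\<in>Y. agree n y y' \<longrightarrow> y' \<in> U)" (is "?lhs \<longleftrightarrow> ?rhs")
proof
  assume ?lhs
  then obtain W where W: "openin (skew_topology G X) W" "U = W \<inter> Y"
    unfolding openin_subtopology by blast
  have "\<exists>n. \<forall>y'\<in>Y. agree n y y' \<longrightarrow> y' \<in> U" if "y \<in> U" for y
  proof -
    obtain g x where y: "y = (g, x)" by (cases y)
    have gx: "(g, x) \<in> W" using that W y by auto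
    obtain A B where AB: "openin (subtopology full_shift_topology X) B"
      "g \<in> A" "x \<in> B" "A \<times> B \<subseteq> W"
      using W(1)[unfolded skew_topology_def openin_prod_topology_alt, rule_format, OF gx] by blast
    obtain V where V: "openin full_shift_topology V" "B = V \<inter> X"
      using AB(1) unfolding openin_subtopology by blast
    obtain n where n: "\<And>x'. (\<forall>i. \<bar>i\<bar> \<le> int n \<longrightarrow> x' i = x i) \<Longrightarrow> x' \<in> V"
      using V AB(3) unfolding openin_full_shift by blast
    have "y' \<in> U" if y'Y: "y' \<in> Y" and ag: "agree n y y'" for y'
    proof -
      obtain x' where y': "y' = (g, x')" using ag y by (cases y') (auto simp: agree_def)
      have "x' \<in> V" using n[of x'] ag y y' by (auto simp: agree_def)
      moreover have "x' \<in> X" using y'Y y' Y by auto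
      ultimately show ?thesis using V AB W y' y'Y by auto
    qed
    then show ?thesis by blast
  qed
  then show ?rhs using W by auto
next
  assume R: ?rhs
  show ?lhs
    unfolding openin_subopen[of _ U]
  proof
    fix y assume y: "y \<in> U"
    obtain g x where gx: "y = (g, x)" by (cases y)
    obtain n where n: "\<And>y'. y' \<in> Y \<Longrightarrow> agree n y y' \<Longrightarrow> y' \<in> U" using R y by blast
    define B where "B = {x'. \<forall>i. \<bar>i\<bar> \<le> int n \<longrightarrow> x' i = x i}"
    have "openin full_shift_topology B" unfolding openin_full_shift B_def by (auto intro!: exI[of _ n])
    then have "openin (subtopology full_shift_topology X) (B \<inter> X)"
      unfolding openin_subtopology by blast
    moreover have "g \<in> carrier G" "x \<in> X" using R y gx Y by auto
    ultimately have "openin (skew_topology G X) ({g} \<times> (B \<inter> X))"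
      unfolding skew_topology_def by (intro openin_prod_Times_iff[THEN iffD2]) auto
    then have "openin (subtopology (skew_topology G X) Y) (({g} \<times> (B \<inter> X)) \<inter> Y)"
      unfolding openin_subtopology by blast
    moreover have "y \<in> ({g} \<times> (B \<inter> X)) \<inter> Y" using R y gx \<open>x \<in> X\<close> by (auto simp: B_def)
    moreover have "({g} \<times> (B \<inter> X)) \<inter> Y \<subseteq> U" using n gx by (auto simp: B_def agree_def)
    ultimately show "\<exists>T. openin (subtopology (skew_topology G X) Y) T \<and> y \<in> T \<and> T \<subseteq> U" by blast
  qed
qed

text \<open>A forbidden factor at positions \<open>i\<close> to \<open>j\<close> is visible on the
  coordinates of absolute value up to \<open>\<bar>i\<bar> + \<bar>j\<bar>\<close>, so the
  complement is open.\<close>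

lemma closedin_shift_space: "closedin full_shift_topology (shift_space \<sigma>)"
proof -
  have "openin full_shift_topology (- shift_space \<sigma>)"
    unfolding openin_full_shift
  proof
    fix x assume "x \<in> - shift_space \<sigma>"
    then obtain i j where ij: "\<And>n a. \<not> sublist (map x [i..j]) ((\<sigma> ^^ n) [a])"
      by (auto simp: shift_space_def)
    have "x' \<in> - shift_space \<sigma>" if "\<forall>k. \<bar>k\<bar> \<le> int (nat (\<bar>i\<bar> + \<bar>j\<bar>)) \<longrightarrow> x' k = x k" for x'
    proof -
      have eq: "map x' [i..j] = map x [i..j]" using that by (intro map_cong) auto
      have "\<not> (\<exists>n a. sublist (map x' [i..j]) ((\<sigma> ^^ n) [a]))" unfolding eq using ij by blast
      then show ?thesis unfolding shift_space_def by blast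
    qed
    then show "\<exists>n. \<forall>x'. (\<forall>k. \<bar>k\<bar> \<le> int n \<longrightarrow> x' k = x k) \<longrightarrow> x' \<in> - shift_space \<sigma>" by blast
  qed
  then show ?thesis by (simp add: closedin_def Compl_eq_Diff_UNIV)
qed

lemma compact_space_skew_topology:
  fixes X :: "(int \<Rightarrow> 'a::finite) set"
  assumes "finite (carrier G)" "closedin full_shift_topology X"
  shows "compact_space (skew_topology G X)"
proof -
  have "compact_space (full_shift_topology :: (int \<Rightarrow> 'a) topology)"
    by (simp add: full_shift_topology_def compact_space_product_topology compact_space_discrete_topology)
  then have "compact_space (subtopology full_shift_topology X)"
    using assms(2) closedin_compact_space compact_space_subtopology by blast
  then show ?thesis
    using assms(1) by (simp add: skew_topology_def compact_space_prod_topology compact_space_discrete_topology)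
qed

text \<open>One radius serves all points of \<open>C\<close>, unlike for open sets. Such sets are
  unions of classes of a single equivalence relation \<open>agree n\<close> on \<open>Y\<close>,
  which is why complements are again of this form.\<close>

definition cylinders :: "('g \<times> (int \<Rightarrow> 'a)) set \<Rightarrow> ('g \<times> (int \<Rightarrow> 'a)) set set" where
  "cylinders Y = {C. C \<subseteq> Y \<and> (\<exists>n. \<forall>y\<in>C. \<forall>y'\<in>Y. agree n y y' \<longrightarrow> y' \<in> C)}"

lemma algebra_cylinders:
  fixes Y :: "('g \<times> (int \<Rightarrow> 'a)) set"
  shows "Sigma_Algebra.algebra Y (cylinders Y)"
  unfolding algebra_iff_Un
proof (intro conjI ballI)
  show "cylinders Y \<subseteq> Pow Y" "{} \<in> cylinders Y" by (auto simp: cylinders_def)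
  show "Y - C \<in> cylinders Y" if C: "C \<in> cylinders Y" for C
  proof -
    obtain n where n: "\<forall>y\<in>C. \<forall>y'\<in>Y. agree n y y' \<longrightarrow> y' \<in> C"
      using C by (auto simp: cylinders_def)
    have "\<forall>y\<in>Y - C. \<forall>y'\<in>Y. agree n y y' \<longrightarrow> y' \<in> Y - C"
      using n agree_sym by blast
    then show ?thesis unfolding cylinders_def by blast
  qed
  show "C \<union> D \<in> cylinders Y" if C: "C \<in> cylinders Y" and D: "D \<in> cylinders Y" for C D
  proof -
    obtain n where n: "\<forall>y\<in>C. \<forall>y'\<in>Y. agree n y y' \<longrightarrow> y' \<in> C"
      using C by (auto simp: cylinders_def)
    obtain m where m: "\<forall>y\<in>D. \<forall>y'\<in>Y. agree m y y' \<longrightarrow> y' \<in> D"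
      using D by (auto simp: cylinders_def)
    have agree_max: "agree n y y'" "agree m y y'" if "agree (max n m) y y'" for y y' :: "'g \<times> (int \<Rightarrow> 'a)"
      using agree_mono[OF that] by simp_all
    have "\<forall>y\<in>C \<union> D. \<forall>y'\<in>Y. agree (max n m) y y' \<longrightarrow> y' \<in> C \<union> D"
      using n m agree_max by blast
    then show ?thesis using C D unfolding cylinders_def by blast
  qed
qed

lemma openin_cylinder:
  assumes "Y \<subseteq> carrier G \<times> X" "C \<in> cylinders Y"
  shows "openin (subtopology (skew_topology G X) Y) C"
  using assms(2) unfolding openin_skew_subtopology[OF assms(1)] cylinders_def by blast

lemma topspace_skew: "topspace (skew_topology G X) = carrier G \<times> X"
  by (simp add: skew_topology_def)

lemma closedin_cylinder:
  assumes "Y \<subseteq> carrier G \<times> X" "C \<in> cylinders Y"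
  shows "closedin (subtopology (skew_topology G X) Y) C"
proof -
  interpret Sigma_Algebra.algebra Y "cylinders Y" by (rule algebra_cylinders)
  have "topspace (subtopology (skew_topology G X) Y) = Y"
    using assms(1) by (auto simp: topspace_skew)
  moreover have "C \<subseteq> Y" using assms(2) by (simp add: cylinders_def)
  moreover have "Y - C \<in> cylinders Y" using assms(2) by (rule compl_sets)
  ultimately show ?thesis using openin_cylinder[OF assms(1)] by (simp add: closedin_def)
qed

text \<open>An open set is the countable union over \<open>n\<close> of the sets of points whose
  whole \<open>agree n\<close> class lies in it, and each of these is a cylinder.\<close>

lemma sigma_sets_cylinders:
  assumes "Y \<subseteq> carrier G \<times> X"
  shows "sets (borel_measurable_space (subtopology (skew_topology G X) Y)) = sigma_sets Y (cylinders Y)"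
proof -
  let ?T = "subtopology (skew_topology G X) Y"
  have top: "topspace ?T = Y" using assms by (auto simp: topspace_skew)
  have "sets (borel_measurable_space ?T) = sigma_sets (topspace ?T) {U. openin ?T U}"
    unfolding borel_measurable_space_def
    by (rule sets_measure_of) (use openin_subset in blast)
  also have "\<dots> = sigma_sets Y (cylinders Y)"
    unfolding top
  proof (rule sigma_sets_eqI)
    fix U assume "U \<in> {U. openin ?T U}"
    then have U: "U \<subseteq> Y" "\<And>y. y \<in> U \<Longrightarrow> \<exists>n. \<forall>y'\<in>Y. agree n y y' \<longrightarrow> y' \<in> U"
      using openin_skew_subtopology[OF assms] by auto
    define D where "D n = {y \<in> Y. \<forall>y'\<in>Y. agree n y y' \<longrightarrow> y' \<in> U}" for n
    have "D n \<in> cylinders Y" for n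
    proof -
      have "\<forall>y\<in>D n. \<forall>y'\<in>Y. agree n y y' \<longrightarrow> y' \<in> D n"
        unfolding D_def using agree_trans by blast
      then show ?thesis unfolding cylinders_def D_def by blast
    qed
    moreover have "U = (\<Union>n. D n)"
      using U unfolding D_def by (auto 0 3)
    ultimately show "U \<in> sigma_sets Y (cylinders Y)"
      by (auto intro: sigma_sets.Union)
  qed (use openin_cylinder[OF assms] in auto)
  finally show ?thesis .
qed

lemma cylinder_vimage:
  assumes "skew_map G \<phi> ` Y \<subseteq> Y" "C \<in> cylinders Y"
  shows "skew_map G \<phi> -` C \<inter> Y \<in> cylinders Y"
proof -
  obtain n where n: "\<forall>y\<in>C. \<forall>y'\<in>Y. agree n y y' \<longrightarrow> y' \<in> C"
    using assms(2) by (auto simp: cylinders_def)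
  have "\<forall>y\<in>skew_map G \<phi> -` C \<inter> Y. \<forall>y'\<in>Y. agree (Suc n) y y' \<longrightarrow> y' \<in> skew_map G \<phi> -` C \<inter> Y"
  proof (intro ballI impI)
    fix y y' assume y: "y \<in> skew_map G \<phi> -` C \<inter> Y" "y' \<in> Y" "agree (Suc n) y y'"
    have "agree n (skew_map G \<phi> y) (skew_map G \<phi> y')" using y(3) by (rule agree_skew_map)
    then show "y' \<in> skew_map G \<phi> -` C \<inter> Y" using n y assms(1) by blast
  qed
  then show ?thesis unfolding cylinders_def by blast
qed

text \<open>This supplies the compactness hypothesis of the measure construction. The union is
  closed in a compact space and its members are open, so finitely many of them cover it;
  disjointness empties the rest.\<close>

lemma disjoint_cylinders_finite:
  fixes X :: "(int \<Rightarrow> 'a::finite) set" and A :: "nat \<Rightarrow> ('g \<times> (int \<Rightarrow> 'a)) set"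
  assumes "finite (carrier G)" "closedin full_shift_topology X" "closedin (skew_topology G X) Y"
    and A: "range A \<subseteq> cylinders Y" "disjoint_family A" "(\<Union>i. A i) \<in> cylinders Y"
  shows "\<exists>n. \<forall>i\<ge>n. A i = {}"
proof -
  let ?T = "subtopology (skew_topology G X) Y"
  have Y: "Y \<subseteq> carrier G \<times> X" using closedin_subset[OF assms(3)] by (simp add: topspace_skew)
  have "compact_space (skew_topology G X)"
    using assms(1,2) by (rule compact_space_skew_topology)
  then have "compact_space ?T"
    using assms(3) closedin_compact_space compact_space_subtopology by blast
  then have "compactin ?T (\<Union>i. A i)"
    using closedin_cylinder[OF Y A(3)] by (rule closedin_compact_space)
  moreover have "\<forall>U\<in>range A. openin ?T U" using openin_cylinder[OF Y] A(1) by blast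
  ultimately obtain \<F> where F: "finite \<F>" "\<F> \<subseteq> range A" "(\<Union>i. A i) \<subseteq> \<Union>\<F>"
    unfolding compactin_def by (metis order_refl)
  obtain J where J: "finite J" "\<F> = A ` J" using F(1,2) by (meson finite_subset_image)
  have "A i = {}" if "i \<ge> Suc (Max (insert 0 J))" for i
  proof -
    have "i \<notin> J"
    proof
      assume "i \<in> J"
      then have "i \<le> Max (insert 0 J)" using J(1) by (intro Max_ge) auto
      then show False using that by simp
    qed
    then have "A i \<inter> A j = {}" if "j \<in> J" for j
      using disjoint_family_onD[OF A(2), of i j] that by auto
    moreover have "A i \<subseteq> (\<Union>j\<in>J. A j)" using F(3) unfolding J(2) by (rule order_trans[rotated]) auto
    ultimately show ?thesis by blast
  qed
  then show ?thesis by blast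
qed

section \<open>Uniform convergence of averages on minimal sets\<close>

context skew_substitution
begin

lemma skew_map_pow:
  assumes "g \<in> carrier G"
  shows "(skew_map G \<phi> ^^ n) (g, x) = (g \<otimes> \<phi> (window x n), \<lambda>i. x (i + int n))"
proof (induction n)
  case 0
  show ?case using assms by (simp add: window_def)
next
  case (Suc n)
  have "window x (Suc n) = window x n @ [x (int n)]" by (simp add: window_def)
  then show ?case using Suc assms
    by (simp add: skew_map_def shift_map_def phi_append m_assoc algebra_simps)
qed

text \<open>A cylinder looks \<open>n\<close> places to either side. After \<open>n\<close> steps
  these are the coordinates \<open>0\<close> to \<open>2 * n\<close> of the original point, and the
  group coordinate is \<open>g\<close> times the value of the first \<open>n\<close> letters; hence
  a one-sided window suffices.\<close>

lemma cylinder_coded_by_window: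
  assumes Y: "Y \<subseteq> carrier G \<times> X" "skew_map G \<phi> ` Y \<subseteq> Y" and C: "C \<in> cylinders Y"
  shows "\<exists>n L F. (\<forall>g w. \<bar>F g w :: real\<bar> \<le> 1) \<and> (\<forall>y\<in>Y.
    indicat_real C ((skew_map G \<phi> ^^ n) y) = (case y of (g, x) \<Rightarrow> F g (window x L)))"
proof -
  obtain n where n: "\<forall>y\<in>C. \<forall>y'\<in>Y. agree n y y' \<longrightarrow> y' \<in> C" and "C \<subseteq> Y"
    using C by (auto simp: cylinders_def)
  define L where "L = 2 * n + 1"
  \<comment> \<open>\<open>F\<close> asks whether some point of \<open>C\<close> shows this window
    and group element. Which point is immaterial, since \<open>C\<close> contains whole
    \<open>agree n\<close> classes of \<open>Y\<close>.\<close>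
  define F :: "'g \<Rightarrow> 'a list \<Rightarrow> real" where "F g w = of_bool (\<exists>x'. (g \<otimes> \<phi> (take n w), x') \<in> C \<and>
    w = window (\<lambda>i. x' (i - int n)) L)" for g w
  have "indicat_real C ((skew_map G \<phi> ^^ n) (g, x)) = F g (window x L)" if y: "(g, x) \<in> Y" for g x
  proof -
    have g: "g \<in> carrier G" using y Y(1) by auto
    have pow: "(skew_map G \<phi> ^^ n) (g, x) = (g \<otimes> \<phi> (window x n), \<lambda>i. x (i + int n))"
      using skew_map_pow[OF g] .
    have inY: "(skew_map G \<phi> ^^ i) (g, x) \<in> Y" for i
      using y Y(2) by (induction i) auto
    have tk: "take n (window x L) = window x n" by (simp add: take_window L_def)
    have "(skew_map G \<phi> ^^ n) (g, x) \<in> C" if x': "(g \<otimes> \<phi> (window x n), x') \<in> C"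
      "window x L = window (\<lambda>i. x' (i - int n)) L" for x'
    proof -
      have "x' i = x (i + int n)" if "\<bar>i\<bar> \<le> int n" for i
      proof -
        define j where "j = nat (i + int n)"
        have j: "j < L" "int j = i + int n" using that by (auto simp: j_def L_def)
        have "window x L ! j = window (\<lambda>i. x' (i - int n)) L ! j" using x'(2) by simp
        then show ?thesis using j by (simp add: window_def)
      qed
      then have "agree n (g \<otimes> \<phi> (window x n), x') ((skew_map G \<phi> ^^ n) (g, x))"
        unfolding pow by (auto simp: agree_def)
      then show ?thesis using n x'(1) inY by blast
    qed
    moreover have "\<exists>x'. (g \<otimes> \<phi> (window x n), x') \<in> C \<and> window x L = window (\<lambda>i. x' (i - int n)) L"
      if "(skew_map G \<phi> ^^ n) (g, x) \<in> C"
      using that unfolding pow by (intro exI[of _ "\<lambda>i. x (i + int n)"]) simp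
    ultimately show ?thesis unfolding F_def tk indicator_def by auto
  qed
  moreover have "\<bar>F g w\<bar> \<le> 1" for g w by (simp add: F_def)
  ultimately show ?thesis by (intro exI[of _ n] exI[of _ L] exI[of _ F]) auto
qed

end

lemma (in idempotent_skew_substitution) uniform_cylinder_averages:
  assumes lang: "\<And>x N n. x \<in> X \<Longrightarrow> \<exists>k\<ge>1. \<exists>c. sublist (window x N) ((\<tau> ^^ (n + k)) [c])"
    and min: "minimal_closed_invariant (skew_topology G X) (skew_map G \<phi>) Y"
    and C: "C \<in> cylinders Y"
  shows "\<exists>c. uniform_limit Y (\<lambda>N y. (\<Sum>i<N. indicat_real C ((skew_map G \<phi> ^^ i) y)) / N)
    (\<lambda>_. c) sequentially"
proof -
  let ?T = "skew_map G \<phi>"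
  have inv: "?T ` Y \<subseteq> Y" and cl: "closedin (skew_topology G X) Y"
    using min by (auto simp: minimal_closed_invariant_def closed_invariant_def)
  have Y: "Y \<subseteq> carrier G \<times> X" using closedin_subset[OF cl] by (simp add: topspace_skew)
  have pow_Y: "(?T ^^ i) y \<in> Y" if "y \<in> Y" for i y using that inv by (induction i) auto
  obtain n L F where F: "\<And>g w. \<bar>F g w :: real\<bar> \<le> 1"
    and code: "\<And>y. y \<in> Y \<Longrightarrow> indicat_real C ((?T ^^ n) y) = (case y of (g, x) \<Rightarrow> F g (window x L))"
    using cylinder_coded_by_window[OF Y inv C] by blast
  from averages_near_finite_set[of F L, OF F] obtain V :: "real set" where V':
    "finite V \<and> (\<forall>e :: real. e > 0 \<longrightarrow> (\<exists>N0. \<forall>w g. length w \<ge> N0 \<longrightarrow> g \<in> carrier G \<longrightarrow>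
      (\<forall>n. \<exists>k\<ge>1. \<exists>c. sublist w ((\<tau> ^^ (n + k)) [c])) \<longrightarrow>
      (\<exists>v\<in>V. \<bar>orbit_sum G \<phi> L F w g - v * length w\<bar> \<le> e * length w)))"
    by (rule exE)
  note V = V'[THEN conjunct1] and near = V'[THEN conjunct2]
  define f where "f y i = indicat_real C ((?T ^^ i) y)" for y i
  have f_bd: "\<bar>f y i\<bar> \<le> 1" for y i by (simp add: f_def indicator_def)
  have f_T: "f (?T y) i = f y (Suc i)" for y i by (simp add: f_def funpow_swap1)
  have near_V: "\<exists>N0. \<forall>N\<ge>N0. \<forall>y\<in>Y. \<exists>v\<in>V. \<bar>(\<Sum>i<N. f y i) / N - v\<bar> \<le> e" if e: "e > 0" for e
  proof -
    obtain N0 where N0: "\<And>w g. length w \<ge> N0 \<Longrightarrow> g \<in> carrier G \<Longrightarrow>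
      (\<forall>n. \<exists>k\<ge>1. \<exists>c. sublist w ((\<tau> ^^ (n + k)) [c])) \<Longrightarrow>
      \<exists>v\<in>V. \<bar>orbit_sum G \<phi> L F w g - v * length w\<bar> \<le> e / 2 * length w"
      using near[THEN spec, of "e / 2"] e by (elim impE exE) (simp, metis)
    \<comment> \<open>\<open>2 * L\<close> pays for truncated windows, \<open>2 * n\<close> for
      starting the sum \<open>n\<close> steps later.\<close>
    obtain N1 :: nat where N1: "(2 * L + 2 * n) / (e / 2) < N1" using reals_Archimedean2 by blast
    have "\<exists>v\<in>V. \<bar>(\<Sum>i<N. f y i) / N - v\<bar> \<le> e" if N: "N \<ge> max N0 (max N1 1)" and y: "y \<in> Y" for N y
    proof -
      obtain g x where gx: "y = (g, x)" by (cases y)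
      have g: "g \<in> carrier G" "x \<in> X" using y gx Y by auto
      obtain v where v: "v \<in> V" "\<bar>orbit_sum G \<phi> L F (window x N) g - v * N\<bar> \<le> e / 2 * N"
        using N0[of "window x N" g] N g lang by auto
      have "f y (i + n) = (case (?T ^^ i) (g, x) of (h, z) \<Rightarrow> F h (window z L))" for i
        using code[OF pow_Y[OF y, of i]] unfolding f_def gx
        by (simp add: funpow_add add.commute[of i n])
      then have "\<bar>(\<Sum>i<N. f y (i + n)) - orbit_sum G \<phi> L F (window x N) g\<bar> \<le> 2 * L"
        using birkhoff_sum_orbit_sum[where F = F and N = N and L = L and G = G and \<phi> = \<phi> and g = g and x = x, OF F] by simp
      moreover have "\<bar>(\<Sum>i<N. f y i) - (\<Sum>i<N. f y (i + n))\<bar> \<le> 2 * n"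
        by (rule sum_shift_diff) (rule f_bd)
      moreover have "2 * L + 2 * n \<le> e / 2 * N"
      proof -
        have "(2 * L + 2 * n) / (e / 2) \<le> N" using N1 N by linarith
        then show ?thesis using e by (simp add: field_simps)
      qed
      ultimately have "\<bar>(\<Sum>i<N. f y i) - v * N\<bar> \<le> e * N" using v(2) by linarith
      moreover have "(\<Sum>i<N. f y i) / N - v = ((\<Sum>i<N. f y i) - v * N) / N"
        using N by (simp add: field_simps)
      ultimately have "\<bar>(\<Sum>i<N. f y i) / N - v\<bar> \<le> e" using N by (simp add: field_simps)
      then show ?thesis using v(1) by blast
    qed
    then show ?thesis by blast
  qed
  obtain c M d where d: "d > 0" and c: "c ` Y \<subseteq> V"
    and sep: "\<And>u v. u \<in> V \<Longrightarrow> v \<in> V \<Longrightarrow> \<bar>u - v\<bar> < 4 * d \<Longrightarrow> u = v"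
    and M: "\<And>y. y \<in> Y \<Longrightarrow> \<bar>(\<Sum>i<M. f y i) / M - c y\<bar> \<le> d"
    and lim: "uniform_limit Y (\<lambda>N y. (\<Sum>i<N. f y i) / N) c sequentially"
    using averages_near_finite_set_converge[OF V f_bd near_V] by blast
  obtain m where m: "\<forall>y\<in>C. \<forall>y'\<in>Y. agree m y y' \<longrightarrow> y' \<in> C"
    using C by (auto simp: cylinders_def)
  \<comment> \<open>Averages at time \<open>M\<close> depend only on the group element and the
    coordinates within distance \<open>m + M\<close>. Equal averages put \<open>c y\<close> and
    \<open>c y'\<close> within \<open>2 * d\<close> of each other, whereas distinct points of
    \<open>V\<close> are at least \<open>4 * d\<close> apart.\<close>
  have c_local: "c y = c y'" if y: "y \<in> Y" "y' \<in> Y" and ag: "agree (m + M) y y'" for y y'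
  proof -
    have "f y i = f y' i" if "i < M" for i
    proof -
      have "agree (m + i) y y'" using ag by (rule agree_mono) (use that in simp)
      then have "agree m ((?T ^^ i) y) ((?T ^^ i) y')" by (rule agree_skew_map_pow)
      then have "(?T ^^ i) y \<in> C \<longleftrightarrow> (?T ^^ i) y' \<in> C"
        using m pow_Y y agree_sym by blast
      then show ?thesis by (simp add: f_def indicator_def)
    qed
    then have "(\<Sum>i<M. f y i) = (\<Sum>i<M. f y' i)" by simp
    then have "\<bar>c y - c y'\<bar> < 4 * d" using M[OF y(1)] M[OF y(2)] d by (simp add: abs_le_iff) linarith
    then show ?thesis using sep c y by blast
  qed
  have c_T: "c (?T y) = c y" if y: "y \<in> Y" for y
  proof -
    have Ty: "?T y \<in> Y" using y inv by blast
    have "(\<lambda>N. (\<Sum>i<N. f (?T y) i) / N - (\<Sum>i<N. f y i) / N) \<longlonglongrightarrow> 0"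
    proof (rule Lim_null_comparison)
      show "\<forall>\<^sub>F N in sequentially. norm ((\<Sum>i<N. f (?T y) i) / N - (\<Sum>i<N. f y i) / N) \<le> 2 / real N"
      proof (intro always_eventually allI)
        fix N
        have "\<bar>(\<Sum>i<N. f y i) - (\<Sum>i<N. f y (i + 1))\<bar> \<le> 2 * real 1"
          using sum_shift_diff[of "f y" N 1, OF f_bd] by simp
        then have "\<bar>(\<Sum>i<N. f (?T y) i) - (\<Sum>i<N. f y i)\<bar> \<le> 2" by (simp add: f_T abs_minus_commute)
        then show "norm ((\<Sum>i<N. f (?T y) i) / N - (\<Sum>i<N. f y i) / N) \<le> 2 / real N"
          by (simp add: divide_right_mono flip: diff_divide_distrib)
      qed
      show "(\<lambda>N. 2 / real N) \<longlonglongrightarrow> 0" by (rule lim_const_over_n)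
    qed
    moreover have "(\<lambda>N. (\<Sum>i<N. f (?T y) i) / N - (\<Sum>i<N. f y i) / N) \<longlonglongrightarrow> c (?T y) - c y"
      by (intro tendsto_diff tendsto_uniform_limitI[OF lim] y Ty)
    ultimately have "c (?T y) - c y = 0" using LIMSEQ_unique by blast
    then show ?thesis by simp
  qed
  obtain y0 where y0: "y0 \<in> Y" using min by (auto simp: minimal_closed_invariant_def)
  define Z where "Z = {y \<in> Y. c y = c y0}"
  have "\<forall>y\<in>Z. \<forall>y'\<in>Y. agree (m + M) y y' \<longrightarrow> y' \<in> Z"
  proof (intro ballI impI)
    fix y y' assume "y \<in> Z" "y' \<in> Y" "agree (m + M) y y'"
    then show "y' \<in> Z" using c_local[of y y'] by (simp add: Z_def)
  qed
  then have "Z \<in> cylinders Y" unfolding cylinders_def Z_def by blast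
  then have "closedin (skew_topology G X) Z"
    using closedin_cylinder[OF Y] closedin_trans_full[OF _ cl] by blast
  moreover have "?T ` Z \<subseteq> Z" using c_T inv by (auto simp: Z_def)
  moreover have "y0 \<in> Z" "Z \<subseteq> Y" using y0 by (auto simp: Z_def)
  ultimately have "Z = Y"
    using min unfolding minimal_closed_invariant_def closed_invariant_def by blast
  then have "c y = c y0" if "y \<in> Y" for y using that by (auto simp: Z_def)
  then have "uniform_limit Y (\<lambda>N y. (\<Sum>i<N. f y i) / N) (\<lambda>_. c y0) sequentially"
    using lim by (subst uniform_limit_cong'[where g = "\<lambda>N y. (\<Sum>i<N. f y i) / N" and i = c]) auto
  then show ?thesis unfolding f_def by blast
qed

lemma (in idempotent_skew_substitution) minimal_uniquely_ergodic:
  assumes X: "closedin full_shift_topology X"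
    and lang: "\<And>x N n. x \<in> X \<Longrightarrow> \<exists>k\<ge>1. \<exists>c. sublist (window x N) ((\<tau> ^^ (n + k)) [c])"
    and min: "minimal_closed_invariant (skew_topology G X) (skew_map G \<phi>) Y"
  shows "uniquely_ergodic (skew_topology G X) (skew_map G \<phi>) Y"
proof -
  have inv: "skew_map G \<phi> ` Y \<subseteq> Y" and cl: "closedin (skew_topology G X) Y" and "Y \<noteq> {}"
    using min by (auto simp: minimal_closed_invariant_def closed_invariant_def)
  have Y: "Y \<subseteq> carrier G \<times> X" using closedin_subset[OF cl] by (simp add: topspace_skew)
  show ?thesis
    unfolding uniquely_ergodic_def invariant_borel_probability_def sigma_sets_cylinders[OF Y]
  proof (rule unique_invariant_probability)
    show "\<exists>n. \<forall>i\<ge>n. A i = {}" if "range A \<subseteq> cylinders Y" "disjoint_family A" "(\<Union>i. A i) \<in> cylinders Y"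
      for A :: "nat \<Rightarrow> _" using disjoint_cylinders_finite[OF finite_carrier X cl that] .
    show "\<exists>c. uniform_limit Y (\<lambda>N y. (\<Sum>i<N. indicat_real C ((skew_map G \<phi> ^^ i) y)) / N)
      (\<lambda>_. c) sequentially" if "C \<in> cylinders Y" for C
      using uniform_cylinder_averages[OF lang min that] .
    show "skew_map G \<phi> -` C \<inter> Y \<in> cylinders Y" if "C \<in> cylinders Y" for C
      using cylinder_vimage[OF inv that] .
    show "Sigma_Algebra.algebra Y (cylinders Y)" by (rule algebra_cylinders)
    show "skew_map G \<phi> ` Y \<subseteq> Y" "Y \<noteq> {}" by fact+
  qed
qed

section \<open>Unique ergodicity\<close>

lemma window_eq_map_upto: "window x N = map x [0..int N - 1]"
proof (rule nth_equalityI)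
  show "window x N ! i = map x [0..int N - 1] ! i" if "i < length (window x N)" for i
    using that by (simp add: window_def nth_upto)
qed simp

theorem proposition8p3:
  fixes \<sigma> :: "'a::finite list \<Rightarrow> 'a list"
    and G :: "('g, 'k) monoid_scheme"
    and \<phi> :: "'a list \<Rightarrow> 'g"
  assumes "substitution \<sigma>"
    and "primitive \<sigma>"
    and "shift_space \<sigma> \<noteq> {}"
    and "group G"
    and "finite (carrier G)"
    and "monoid_morphism free_monoid G \<phi>"
    and "range \<phi> = carrier G"
    and "invertible_under \<phi> \<sigma>"
  shows "\<forall>Y. minimal_closed_invariant (skew_topology G (shift_space \<sigma>)) (skew_map G \<phi>) Y \<longrightarrow>
             uniquely_ergodic (skew_topology G (shift_space \<sigma>)) (skew_map G \<phi>) Y"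
proof -
  interpret group G by fact
  have \<sigma>_append: "\<sigma> (u @ v) = \<sigma> u @ \<sigma> v" for u v
    using assms(1) by (simp add: substitution_def monoid_morphism_def free_monoid_def hom_def)
  have \<sigma>_Nil: "\<sigma> [] = []"
    using assms(1) by (simp add: substitution_def monoid_morphism_def free_monoid_def)
  have \<phi>_append: "\<phi> (u @ v) = \<phi> u \<otimes>\<^bsub>G\<^esub> \<phi> v" and \<phi>_closed: "\<phi> u \<in> carrier G" for u v
    using assms(6) by (auto simp: monoid_morphism_def free_monoid_def hom_def)
  have pow_append: "(\<sigma> ^^ n) (u @ v) = (\<sigma> ^^ n) u @ (\<sigma> ^^ n) v" for n u v
    by (induction n) (simp_all add: \<sigma>_append)
  have pow_Nil: "(\<sigma> ^^ n) [] = []" for n by (induction n) (simp_all add: \<sigma>_Nil)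
  obtain m where m: "m \<ge> 1" "\<And>a b. b \<in> set ((\<sigma> ^^ m) [a])"
    using assms(2) by (auto simp: primitive_def)
  obtain p where p: "p \<ge> 1" "\<phi> \<circ> (\<sigma> ^^ p) = \<phi>"
    using assms(8) by (auto simp: invertible_under_def)
  have nonempty: "(\<sigma> ^^ n) [a] \<noteq> []" for n a
  proof (induction n)
    case (Suc n)
    \<comment> \<open>If \<open>\<sigma>\<close> erased \<open>b\<close>, then so would
      \<open>\<sigma> ^^ m\<close>, although every letter occurs in that image.\<close>
    have letter: "\<sigma> [b] \<noteq> []" for b
    proof
      assume "\<sigma> [b] = []"
      moreover have "(\<sigma> ^^ m) [b] = (\<sigma> ^^ (m - 1)) (\<sigma> [b])"
        using m(1) by (cases m) (simp_all add: funpow_swap1)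
      ultimately show False using m(2)[of b b] by (simp add: pow_Nil)
    qed
    obtain b w where "(\<sigma> ^^ n) [a] = [b] @ w" using Suc by (cases "(\<sigma> ^^ n) [a]") auto
    then show ?case using letter[of b] by (simp add: \<sigma>_append[of "[b]" w, simplified])
  qed simp
  have positive: "b \<in> set ((\<sigma> ^^ n) [a])" if "n \<ge> m" for n a b
  proof -
    obtain c w where "(\<sigma> ^^ (n - m)) [a] = [c] @ w"
      using nonempty[of "n - m" a] by (cases "(\<sigma> ^^ (n - m)) [a]") auto
    moreover have "(\<sigma> ^^ n) [a] = (\<sigma> ^^ m) ((\<sigma> ^^ (n - m)) [a])"
      using that by (metis comp_apply funpow_add le_add_diff_inverse)
    ultimately show ?thesis using m(2)[of b c] by (simp only: pow_append set_append) simp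
  qed
  \<comment> \<open>A multiple of \<open>p\<close> leaves \<open>\<phi>\<close> invariant, and the
    factor \<open>m\<close> makes the final exponent \<open>Q\<close> at least \<open>m\<close>, as
    positivity requires.\<close>
  define \<tau>0 where "\<tau>0 = \<sigma> ^^ (p * m)"
  have \<phi>_pow: "\<phi> ((\<sigma> ^^ (p * k)) u) = \<phi> u" for k u
  proof (induction k)
    case (Suc k)
    have "(\<sigma> ^^ (p * Suc k)) u = (\<sigma> ^^ p) ((\<sigma> ^^ (p * k)) u)" by (simp add: funpow_add)
    then show ?case using Suc fun_cong[OF p(2), of "(\<sigma> ^^ (p * k)) u"] by simp
  qed simp
  interpret A: skew_substitution G \<phi> \<tau>0
    by unfold_locales (simp_all add: assms(5) \<phi>_closed \<phi>_append \<tau>0_def pow_append \<phi>_pow)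
  obtain q where q: "q \<ge> 1" "\<And>k. k \<ge> 1 \<Longrightarrow> A.occ (q * k) = A.occ q"
    using A.idempotent_power by blast
  define Q where "Q = p * m * q"
  define \<tau> where "\<tau> = \<tau>0 ^^ q"
  have \<tau>_\<sigma>: "\<tau> ^^ k = \<sigma> ^^ (Q * k)" for k
    by (simp add: \<tau>_def \<tau>0_def Q_def funpow_mult)
  have \<tau>_eq: "\<tau> = \<sigma> ^^ Q" using \<tau>_\<sigma>[of 1] by simp
  have Q: "Q \<ge> m" "Q \<ge> 1" using p(1) m(1) q(1) by (simp_all add: Q_def)
  have lang: "\<exists>k\<ge>1. \<exists>c. sublist (window x N) ((\<tau> ^^ (n + k)) [c])" if x: "x \<in> shift_space \<sigma>" for x N n
  proof -
    obtain l a where l: "sublist (window x N) ((\<sigma> ^^ l) [a])"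
      using x unfolding window_eq_map_upto shift_space_def by blast
    \<comment> \<open>With this \<open>k\<close>, at least \<open>m\<close> iterations are available
      beyond the \<open>l\<close> that produce the window. Their image of \<open>a\<close> contains
      \<open>a\<close> again, so the window persists at level \<open>n + k\<close>.\<close>
    define k where "k = l + m"
    define r where "r = Q * (n + k) - l"
    have "l + m \<le> n + k" by (simp add: k_def)
    also have "\<dots> \<le> Q * (n + k)" using Q(2) by simp
    finally have r: "Q * (n + k) = l + r" "r \<ge> m" by (simp_all add: r_def)
    obtain u v where "(\<sigma> ^^ r) [a] = u @ [a] @ v"
      using split_list[OF positive[OF r(2), of a a]] by auto
    then have "(\<tau> ^^ (n + k)) [a] = (\<sigma> ^^ l) u @ (\<sigma> ^^ l) [a] @ (\<sigma> ^^ l) v"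
      by (simp only: \<tau>_\<sigma> r(1) funpow_add comp_apply pow_append)
    then have "sublist ((\<sigma> ^^ l) [a]) ((\<tau> ^^ (n + k)) [a])" by (auto simp: sublist_def)
    then have "sublist (window x N) ((\<tau> ^^ (n + k)) [a])" using l sublist_order.order.trans by blast
    moreover have "k \<ge> 1" using m(1) by (simp add: k_def)
    ultimately show ?thesis by blast
  qed
  \<comment> \<open>Nonemptiness of the shift space enters here: an image of length at most one
    would force a one-letter alphabet with \<open>\<tau>\<close> fixing its letter, and then no
    factor of length two could occur.\<close>
  have len: "length (\<tau> [a]) \<ge> 2" for a
  proof (rule ccontr)
    assume "\<not> length (\<tau> [a]) \<ge> 2"
    moreover have all: "b \<in> set (\<tau> [c])" for b c using positive[OF Q(1)] by (simp add: \<tau>_eq)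
    ultimately obtain b where b: "\<tau> [a] = [b]"
      using all[of a a] by (cases "\<tau> [a]") (auto simp: Suc_le_eq)
    have "c = b" for c using all[of c a] b by simp
    then have single: "c = a" for c by metis
    have pow: "(\<tau> ^^ k) [a] = [a]" for k by (induction k) (simp_all add: b single[of b])
    obtain x where x: "x \<in> shift_space \<sigma>" using assms(3) by blast
    obtain k c where "sublist (window x 2) ((\<tau> ^^ (0 + k)) [c])" using lang[OF x] by blast
    then have "sublist (window x 2) [a]" using pow single[of c] by simp
    then show False using sublist_length_le by fastforce
  qed
  interpret B: skew_substitution G \<phi> \<tau>
    by unfold_locales
      (simp_all add: assms(5) \<phi>_closed \<phi>_append \<tau>_eq pow_append \<phi>_pow Q_def mult.assoc)
  \<comment> \<open>Level \<open>k\<close> for \<open>\<tau>\<close> is level \<open>q * k\<close>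
    for \<open>\<tau>0\<close>, so the choice of \<open>q\<close> becomes idempotence from the first
    level on.\<close>
  have occ: "B.occ k = A.occ (q * k)" for k
    using funpow_mult[of k q \<tau>0] by (simp add: B.occ_def A.occ_def fun_eq_iff flip: \<tau>_def)
  interpret idempotent_skew_substitution G \<phi> \<tau>
  proof unfold_locales
    show "b \<in> set (\<tau> [a])" for a b using positive[OF Q(1)] by (simp add: \<tau>_eq)
    show "B.occ k = B.occ 1" if "k \<ge> 1" for k using q(2)[OF that] by (simp add: occ)
  qed (rule len)
  show ?thesis
    using minimal_uniquely_ergodic[OF closedin_shift_space lang] by blast
qed

end
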